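(* Let $p\in(0,1)$ and $q=p$. Let $(z_1,z_2)\in\mathbb D^2$ be in Region 2, and let $u=e^{i\theta}\in\mathbb T$ and $z\in A(u)$ be such that $(z_1,z_2)\in G_z(\phi_z(\mathbb D))$ (so $(z_1,z_2)\in S(u)$). Then the Carathéodory distance on the symmetrized bidisk $G$ satisfies $$C_G\big((z_1+z_2,z_1z_2),(p,0)\big)=\exp g_{\mathbb D^2}((z_1,z_2),(p,0),(0,p))=\sup_{\tau\in\mathbb T}\left|\frac{pz_1z_2\tau^2-2z_1z_2\tau+(z_1+z_2)-p}{(z_1+z_2)\tau^2-pz_1z_2\tau^2-2\tau+p}\right|,$$ the supremum is attained at $\tau=e^{-i\theta}$, and $u=e^{i\theta}$ is a root of the fourth degree polynomial equation $$\overline zpe^{4i\theta}-\overline ze^{3i\theta}-pe^{3i\theta}+pe^{i\theta}-pz+e^{i\theta}z=0.$$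
   Context: $\mathbb D$ is the unit disk in $\mathbb C$, $\mathbb T$ the unit circle, $m_a(\lambda)=\frac{a-\lambda}{1-\overline a\lambda}$ for $a\in\mathbb D$. $G=\{(z_1+z_2,z_1z_2):z_1,z_2\in\mathbb D\}$ is the symmetrized bidisk. The Carathéodory distance is normalized without $\tanh^{-1}$: $C_G(x,y)=\sup\{d(f(x),f(y)):f:G\to\mathbb D\text{ holomorphic}\}$, $d(a,b)=\left|\frac{a-b}{1-\overline ab}\right|$. Green function: for distinct $P,Q\in\mathbb D^2$, $g_{\mathbb D^2}(x,P,Q)$ is the supremum of $f(x)$ over all negative plurisubharmonic $f$ on $\mathbb D^2$ (values in $[-\infty,0)$) with logarithmic poles of weight $1$ at $P$ and $Q$, i.e. $f(y)-\log|y-a|\le O(1)$ as $y\to a$ for $a\in\{P,Q\}$. Regions (for fixed $p,q\in(0,1)$; here $q=p$). Region 1: the set of $(z_1,z_2)\in\mathbb D^2$ such that (i) $|z_2|<|m_{z_1}(p)|$, $|m_{z_2}(q)|<|z_1|$ and $\big|m_{m_{z_2}(q)/z_1}(z_2/m_{z_1}(p))\big|\le p$; or (ii) $|m_{z_1}(p)|<|z_2|$, $|z_1|<|m_{z_2}(q)|$ and $\big|m_{z_1/m_{z_2}(q)}(m_{z_1}(p)/z_2)\big|\le q$; or (iii) $z_2=\omega m_{z_1}(p)$ and $m_{z_2}(q)=\omega z_1$ for some $|\omega|=1$. Region 3: the set where $|m_{z_1}(p)|=|z_2|$ or $|z_1|=|m_{z_2}(q)|$. Region 2: all points of $\mathbb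 D^2$ in neither Region 1 nor Region 3. Sets $A(u)$, $u\in\mathbb T$: $A(1)=\{x\in(-1,1):-p<x<\min\{1,p/q\}\}$, $A(-1)=\{x\in(-1,1):\max\{-1,-p/q\}<x<-p\}$; for $u\ne\pm1$, $A(u)$ is the set of $z\in\mathbb D\setminus(-1,1)$ with $|z|<p/q$ such that $$(u-z)(\overline zu-1)(u^2-1)^2p^2-(u-q)(\overline zu^2-z)^2(qu-1)=0,\qquad 0<T<1,\qquad \max\{|z|^2,p^2\}<R<1,$$ where $$R=\frac{(u-q)(\overline z-z)(\overline zu^2-z)(uq-1)}{(\overline zq^2u^2-|z|^2qu^2+\overline zu^2-qu^2-2\overline zqu+2quz+q|z|^2-q^2z+q-z)(u^2-1)},$$ $$T=\frac{q(\overline zqu^2-u^2-\overline zu+uz-qz+1)(\overline zu-1)(u-z)}{Q},$$ $Q=u^4\overline z^2q^2-u^4\overline z|z|^2q-u^3\overline z^2q+u^3\overline z|z|^2-2u^3\overline zq^2+2u^3|z|^2q-\overline zu^3+u^3q+3u^2\overline zq-3u^2qz-2|z|^2uq-|z|^2uz+2uq^2z+uqz^2+|z|^2qz-uq+uz-q^2z^2$. Disks: for $z\in A(u)$, $\phi_z(\lambda)=(\lambda m_\alpha(\lambda),\omega\lambda m_\beta(\lambda))$, where $\alpha,\beta,c\in\mathbb D$, $\omega\in\mathbb T$, $t\in(0,1)$ are such that, with $\gamma=t\alpha+(1-t)\beta$, one has $\alpha=m_\gamma(c)$, $cm_\alpha(c)=p$, $\omega cm_\beta(c)=z$, $\omega\alpha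 m_\beta(\alpha)=m_z(q)$, and, writing $c=rv$ with $r>0,|v|=1$, $\omega v^2=u$; these parameters are determined up to replacing $(\alpha,\beta,c)$ by $(-\alpha,-\beta,-c)$, which does not change $\phi_z(\mathbb D)$. $G_z(\lambda_1,\lambda_2)=(\lambda_1,m_z(\lambda_2))$ and $S(u)=\bigcup_{z\in A(u)}G_z(\phi_z(\mathbb D))$. *)

theory Defs
  imports "HOL-Analysis.Analysis"
begin

definition mob :: "complex \<Rightarrow> complex \<Rightarrow> complex" where
  "mob a w = (a - w) / (1 - cnj a * w)"

definition pdist :: "complex \<Rightarrow> complex \<Rightarrow> real" where
  "pdist a b = cmod ((a - b) / (1 - cnj a * b))"

abbreviation unit_disk :: "complex set" where
  "unit_disk \<equiv> ball 0 1"

abbreviation unit_circle :: "complex set" where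
  "unit_circle \<equiv> sphere 0 1"

abbreviation bidisk :: "(complex \<times> complex) set" where
  "bidisk \<equiv> unit_disk \<times> unit_disk"

definition sym_bidisk :: "(complex \<times> complex) set" where
  "sym_bidisk = {(z1 + z2, z1 * z2) | z1 z2. z1 \<in> unit_disk \<and> z2 \<in> unit_disk}"


subsection \<open>The Caratheodory distance\<close>

text \<open>Holomorphy in two variables: the Frechet derivative exists and is complex linear.
  This is only meant for open \<open>U\<close>.\<close>

definition holomorphic2_on :: "(complex \<times> complex \<Rightarrow> complex) \<Rightarrow> (complex \<times> complex) set \<Rightarrow> bool" where
  "holomorphic2_on f U \<longleftrightarrow>
     (\<forall>x\<in>U. \<exists>a b. (f has_derivative (\<lambda>h. a * fst h + b * snd h)) (at x))"

text \<open>Normalized without the inverse hyperbolic tangent; the set is bounded by \<open>1\<close>.\<close>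

definition caratheodory :: "(complex \<times> complex) set \<Rightarrow> complex \<times> complex \<Rightarrow> complex \<times> complex \<Rightarrow> real" where
  "caratheodory U x y =
     Sup {pdist (f x) (f y) | f. holomorphic2_on f U \<and> f ` U \<subseteq> unit_disk}"


subsection \<open>The two-pole pluricomplex Green function of the bidisk\<close>

text \<open>Mean over the unit circle of an extended real valued function, with the integral split
  into positive and negative parts.  An upper semicontinuous function is bounded above on a
  compact set, so in the definition below the first integral is finite and no \<open>\<infinity> - \<infinity>\<close> occurs.\<close>

definition circle_mean :: "(complex \<Rightarrow> ereal) \<Rightarrow> ereal" where
  "circle_mean h =
     (enn2ereal (\<integral>\<^sup>+\<theta>\<in>{0..2*pi}. e2ennreal (h (cis \<theta>)) \<partial>lborel)
      - enn2ereal (\<integral>\<^sup>+\<theta>\<in>{0..2*pi}. e2ennreal (- h (cis \<theta>)) \<partial>lborel)) / ereal (2 * pi)"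

text \<open>Upper semicontinuity together with the sub-mean value inequality on every closed affine
  disk contained in \<open>U\<close>.  The function that is constantly \<open>-\<infinity>\<close> is admitted.\<close>

definition plurisubharmonic_on :: "(complex \<times> complex \<Rightarrow> ereal) \<Rightarrow> (complex \<times> complex) set \<Rightarrow> bool" where
  "plurisubharmonic_on f U \<longleftrightarrow>
     (\<forall>x\<in>U. f x < \<infinity>) \<and>
     (\<forall>x\<in>U. \<forall>M. f x < M \<longrightarrow> (\<forall>\<^sub>F y in at x within U. f y < M)) \<and>
     (\<forall>a1 a2 b1 b2. (\<forall>w\<in>cball 0 1. (a1 + w * b1, a2 + w * b2) \<in> U) \<longrightarrow>
        f (a1, a2) \<le> circle_mean (\<lambda>w. f (a1 + w * b1, a2 + w * b2)))"

definition log_pole :: "(complex \<times> complex \<Rightarrow> ereal) \<Rightarrow> (complex \<times> complex) set \<Rightarrow> complex \<times> complex \<Rightarrow> bool" where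
  "log_pole f U a \<longleftrightarrow>
     (\<exists>C::real. \<forall>\<^sub>F y in at a within U. f y \<le> ereal (ln (norm (y - a)) + C))"

definition green :: "complex \<times> complex \<Rightarrow> complex \<times> complex \<Rightarrow> complex \<times> complex \<Rightarrow> ereal" where
  "green x P Q = Sup {f x | f. plurisubharmonic_on f bidisk \<and> (\<forall>y\<in>bidisk. f y < 0) \<and>
     log_pole f bidisk P \<and> log_pole f bidisk Q}"

definition exp_ereal :: "ereal \<Rightarrow> ereal" where
  "exp_ereal x = (case x of ereal r \<Rightarrow> ereal (exp r) | PInfty \<Rightarrow> \<infinity> | MInfty \<Rightarrow> 0)"


subsection \<open>The regions of the bidisk\<close>

definition region1 :: "real \<Rightarrow> real \<Rightarrow> (complex \<times> complex) set" where
  "region1 p q = {(z1, z2) \<in> bidisk.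
     (cmod z2 < cmod (mob z1 p) \<and> cmod (mob z2 q) < cmod z1 \<and>
      cmod (mob (mob z2 q / z1) (z2 / mob z1 p)) \<le> p) \<or>
     (cmod (mob z1 p) < cmod z2 \<and> cmod z1 < cmod (mob z2 q) \<and>
      cmod (mob (z1 / mob z2 q) (mob z1 p / z2)) \<le> q) \<or>
     (\<exists>\<omega>\<in>unit_circle. z2 = \<omega> * mob z1 p \<and> mob z2 q = \<omega> * z1)}"

definition region3 :: "real \<Rightarrow> real \<Rightarrow> (complex \<times> complex) set" where
  "region3 p q = {(z1, z2) \<in> bidisk. cmod (mob z1 p) = cmod z2 \<or> cmod z1 = cmod (mob z2 q)}"

definition region2 :: "real \<Rightarrow> real \<Rightarrow> (complex \<times> complex) set" where
  "region2 p q = bidisk - (region1 p q \<union> region3 p q)"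


subsection \<open>The sets \<open>A(u)\<close>\<close>

definition A_R :: "real \<Rightarrow> complex \<Rightarrow> complex \<Rightarrow> complex" where
  "A_R q' u z = (let q = complex_of_real q'; zb = cnj z; n = complex_of_real ((cmod z)\<^sup>2) in
     ((u - q) * (zb - z) * (zb * u^2 - z) * (u * q - 1)) /
     ((zb * q^2 * u^2 - n * q * u^2 + zb * u^2 - q * u^2 - 2 * zb * q * u + 2 * q * u * z
        + q * n - q^2 * z + q - z) * (u^2 - 1)))"

definition A_Q :: "real \<Rightarrow> complex \<Rightarrow> complex \<Rightarrow> complex" where
  "A_Q q' u z = (let q = complex_of_real q'; zb = cnj z; n = complex_of_real ((cmod z)\<^sup>2) in
     u^4 * zb^2 * q^2 - u^4 * zb * n * q - u^3 * zb^2 * q + u^3 * zb * n - 2 * u^3 * zb * q^2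
     + 2 * u^3 * n * q - zb * u^3 + u^3 * q + 3 * u^2 * zb * q - 3 * u^2 * q * z
     - 2 * n * u * q - n * u * z + 2 * u * q^2 * z + u * q * z^2 + n * q * z
     - u * q + u * z - q^2 * z^2)"

definition A_T :: "real \<Rightarrow> complex \<Rightarrow> complex \<Rightarrow> complex" where
  "A_T q' u z = (let q = complex_of_real q'; zb = cnj z in
     (q * (zb * q * u^2 - u^2 - zb * u + u * z - q * z + 1) * (zb * u - 1) * (u - z)) / A_Q q' u z)"

text \<open>An inequality between complex expressions includes the claim that they are real.
  A vanishing denominator gives the value \<open>0\<close>, which the strict inequalities exclude.\<close>

definition A_set :: "real \<Rightarrow> real \<Rightarrow> complex \<Rightarrow> complex set" where
  "A_set p q u =
     (if u = 1 then complex_of_real ` {x. -1 < x \<and> x < 1 \<and> -p < x \<and> x < min 1 (p / q)}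
      else if u = -1 then complex_of_real ` {x. -1 < x \<and> x < 1 \<and> max (-1) (-p / q) < x \<and> x < -p}
      else {z \<in> unit_disk - complex_of_real ` {-1<..<1}.
        cmod z < p / q \<and>
        (u - z) * (cnj z * u - 1) * (u^2 - 1)^2 * p^2
          - (u - q) * (cnj z * u^2 - z)^2 * (q * u - 1) = 0 \<and>
        A_T q u z \<in> \<real> \<and> 0 < Re (A_T q u z) \<and> Re (A_T q u z) < 1 \<and>
        A_R q u z \<in> \<real> \<and> max ((cmod z)\<^sup>2) (p\<^sup>2) < Re (A_R q u z) \<and> Re (A_R q u z) < 1})"


subsection \<open>The extremal disks\<close>

definition disk_params ::
    "real \<Rightarrow> real \<Rightarrow> complex \<Rightarrow> complex \<Rightarrow> complex \<Rightarrow> complex \<Rightarrow> complex \<Rightarrow> complex \<Rightarrow> real \<Rightarrow> bool" where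
  "disk_params p q u z \<alpha> \<beta> c \<omega> t \<longleftrightarrow>
     \<alpha> \<in> unit_disk \<and> \<beta> \<in> unit_disk \<and> c \<in> unit_disk \<and> \<omega> \<in> unit_circle \<and> 0 < t \<and> t < 1 \<and>
     (let \<gamma> = of_real t * \<alpha> + of_real (1 - t) * \<beta> in \<alpha> = mob \<gamma> c) \<and>
     c * mob \<alpha> c = p \<and> \<omega> * c * mob \<beta> c = z \<and> \<omega> * \<alpha> * mob \<beta> \<alpha> = mob z q \<and>
     (\<exists>(r::real) v. c = of_real r * v \<and> r > 0 \<and> cmod v = 1 \<and> \<omega> * v^2 = u)"

definition phi :: "complex \<Rightarrow> complex \<Rightarrow> complex \<Rightarrow> complex \<Rightarrow> complex \<times> complex" where
  "phi \<alpha> \<beta> \<omega> w = (w * mob \<alpha> w, \<omega> * w * mob \<beta> w)"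

text \<open>The image of the disk attached to \<open>z \<in> A(u)\<close>.  The parameters are unique up to
  simultaneously changing the signs of \<open>\<alpha>, \<beta>, c\<close>, which does not change the image; instead of
  choosing one set of parameters we take the union over all of them.\<close>

definition phi_image :: "real \<Rightarrow> real \<Rightarrow> complex \<Rightarrow> complex \<Rightarrow> (complex \<times> complex) set" where
  "phi_image p q u z =
     {phi \<alpha> \<beta> \<omega> w | \<alpha> \<beta> c \<omega> t w. disk_params p q u z \<alpha> \<beta> c \<omega> t \<and> w \<in> unit_disk}"

definition G_map :: "complex \<Rightarrow> complex \<times> complex \<Rightarrow> complex \<times> complex" where
  "G_map z x = (fst x, mob z (snd x))"

definition sym_quot :: "real \<Rightarrow> complex \<Rightarrow> complex \<Rightarrow> complex \<Rightarrow> real" where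
  "sym_quot p z1 z2 \<tau> =
     cmod ((p * z1 * z2 * \<tau>^2 - 2 * z1 * z2 * \<tau> + (z1 + z2) - p) /
           ((z1 + z2) * \<tau>^2 - p * z1 * z2 * \<tau>^2 - 2 * \<tau> + p))"

end

theory Submission
  imports Defs "HOL-Complex_Analysis.Complex_Analysis"
begin

text \<open>
  Four quantities are compared at a point \<open>(z1, z2)\<close> of the extremal disk, say the image of the
  parameter \<open>w\<close>.  For unimodular \<open>\<tau>\<close>, \<open>sym_quot p z1 z2 \<tau>\<close> is the pseudohyperbolic distance
  between the values of a holomorphic map of the symmetrized bidisk into the disk (\<open>magic \<tau>\<close>), hence
  at most the Caratheodory distance.  The logarithm of the distance realized by any such map, pulled
  back by the symmetrization, has both poles and competes in the definition of the Green function
  (\<open>elog_pdist_le_green\<close>).  The disk passes through the poles \<open>(p, 0)\<close> and \<open>(0, p)\<close> at the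
  parameters \<open>c\<close> and \<open>\<alpha>\<close>, so the Green function is at most the logarithm of
  \<open>cmod (mob c w * mob \<alpha> w)\<close> (\<open>green_le_along_disk\<close>).  Everything is therefore equal as soon as
  \<open>sym_quot p z1 z2 (cnj u) = cmod (mob c w * mob \<alpha> w)\<close>.

  This last identity is algebra.  After a rotation of the parameter, \<open>c\<close> is a positive number \<open>r\<close>.
  The condition \<open>\<alpha> = mob \<gamma> r\<close> says that \<open>\<beta>\<close> lies on the line through \<open>\<alpha>\<close> and \<open>1 / r\<close>.  With
  \<open>b = mob \<beta> r\<close>, the equality of the two pole parameters \<open>p\<close> and \<open>q\<close> turns the remaining
  conditions into \<open>cmod (mob b \<alpha>) = r\<close>; on that line this equation for a modulus is a linear
  equation for the position of \<open>\<beta>\<close>, and its solution satisfies \<open>mob b \<alpha> = r\<close>.  So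
  \<open>\<alpha> = mob b r\<close>, \<open>p = u * r * mob r \<alpha>\<close> and \<open>z = u * r * b\<close>: all data are explicit in \<open>r\<close>, \<open>b\<close> and
  \<open>u\<close>.  The quartic equation for \<open>u\<close> follows by substitution.  Numerator and denominator of
  \<open>sym_quot\<close> along the disk share a quadratic factor, coming from the two boundary points that the
  disk sends to \<open>(u, u)\<close>, and what is left is the Blaschke product with zeros \<open>c\<close> and \<open>\<alpha>\<close>.

  On the analytic side, plurisubharmonicity is tested on affine disks only, whereas the extremal
  disk is curved.  The maximum principle along a curved disk
  (\<open>psh_maximum_principle_along_disk\<close>) is obtained by maximizing over the parameter of the disk
  and a small translation at once, with a quadratic penalty on the translation: at a maximum the
  affine disk tangent to the curved one is a competitor, and the sub-mean value inequality on it
  is violated.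
\<close>

section \<open>Automorphisms of the disk\<close>

lemma cnj_mult_ne_1:
  assumes "cmod a < 1" "cmod w \<le> 1"
  shows "1 - cnj a * w \<noteq> 0"
proof
  assume "1 - cnj a * w = 0"
  then have "cmod (cnj a * w) = 1"
    by (metis eq_iff_diff_eq_0 norm_one)
  moreover have "cmod (cnj a * w) < 1"
    using assms mult_mono[of "cmod a" "cmod a" "cmod w" 1] by (simp add: norm_mult)
  ultimately show False by simp
qed

lemma cmod_diff_less_cnj:
  assumes "cmod a < 1" "cmod w < 1"
  shows "cmod (a - w) < cmod (1 - cnj a * w)"
proof -
  have "(cmod (1 - cnj a * w))\<^sup>2 - (cmod (a - w))\<^sup>2 = (1 - (cmod a)\<^sup>2) * (1 - (cmod w)\<^sup>2)"
    unfolding cmod_power2 by (simp add: algebra_simps power2_eq_square)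
  moreover have "\<dots> > 0"
    using assms by (simp add: abs_square_less_1)
  ultimately show ?thesis
    by (smt (verit) norm_ge_zero power_mono)
qed

lemma mob_in_disk:
  assumes "cmod a < 1" "cmod w < 1"
  shows "cmod (mob a w) < 1"
  unfolding mob_def using cmod_diff_less_cnj[OF assms] by (simp add: norm_divide divide_less_eq)

lemma mob_mob:
  assumes "cmod a < 1" "cmod w < 1"
  shows "mob a (mob a w) = w"
proof -
  have 1: "1 - cnj a * w \<noteq> 0" "1 - cnj a * a \<noteq> 0"
    using assms cnj_mult_ne_1 by auto
  have 2: "a - mob a w = w * (1 - cnj a * a) / (1 - cnj a * w)"
    "1 - cnj a * mob a w = (1 - cnj a * a) / (1 - cnj a * w)"
    using 1 by (simp_all add: mob_def field_simps)
  show ?thesis unfolding mob_def[of a "mob a w"] 2 using 1 by simp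
qed

lemma mob_rotate:
  assumes "cmod v = 1"
  shows "mob (v * a) (v * w) = v * mob a w"
proof -
  have "v * cnj v = 1" using assms by (simp add: complex_norm_square[symmetric])
  then have "cnj (v * a) * (v * w) = cnj a * w"
    by (metis complex_cnj_mult mult.assoc mult.commute mult.right_neutral)
  then show ?thesis unfolding mob_def by (simp add: right_diff_distrib)
qed

lemma cmod_mob_commute: "cmod (mob a w) = cmod (mob w a)"
proof -
  have "cmod (1 - cnj a * w) = cmod (1 - cnj w * a)"
    by (metis complex_cnj_cnj complex_cnj_diff complex_cnj_mult complex_cnj_one complex_mod_cnj mult.commute)
  then show ?thesis by (simp add: mob_def norm_divide norm_minus_commute)
qed

text \<open>
  The left-hand side is a Blaschke product of degree two in \<open>\<mu>\<close> that vanishes at \<open>c\<close> and at the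
  other point, \<open>mob \<beta> c\<close>, where \<open>\<mu> * mob \<beta> \<mu>\<close> takes the same value.
\<close>

lemma mob_blaschke:
  assumes "cmod c < 1" "cmod \<beta> < 1" "cmod \<mu> < 1"
  shows "mob (c * mob \<beta> c) (\<mu> * mob \<beta> \<mu>) = mob c \<mu> * mob (mob \<beta> c) \<mu>"
proof -
  define C B where "C = cnj c" and "B = cnj \<beta>"
  have nz: "1 - B * c \<noteq> 0" "1 - B * \<mu> \<noteq> 0" "1 - \<beta> * C \<noteq> 0" "1 - C * \<mu> \<noteq> 0"
    using assms cnj_mult_ne_1[of \<beta> c] cnj_mult_ne_1[of \<beta> \<mu>] cnj_mult_ne_1[of c \<beta>] cnj_mult_ne_1[of c \<mu>]
    by (auto simp: B_def C_def mult.commute)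
  have b: "cmod (mob \<beta> c) < 1" using assms mob_in_disk by blast
  have "cnj (mob \<beta> c) = (B - C) / (1 - \<beta> * C)"
    by (simp add: mob_def B_def C_def)
  note cb = this
  have nz5: "1 - (B - C) / (1 - \<beta> * C) * \<mu> \<noteq> 0"
    using cnj_mult_ne_1[OF b, of \<mu>] assms unfolding cb by auto
  have 1: "c * mob \<beta> c - \<mu> * mob \<beta> \<mu> = (c - \<mu>) * (mob \<beta> c - \<mu>) / (1 - B * \<mu>)"
    unfolding mob_def B_def[symmetric] using nz by (simp add: divide_simps) algebra
  have 2: "1 - cnj (c * mob \<beta> c) * (\<mu> * mob \<beta> \<mu>) = (1 - C * \<mu>) * (1 - cnj (mob \<beta> c) * \<mu>) / (1 - B * \<mu>)"
    unfolding complex_cnj_mult cb unfolding mob_def B_def[symmetric] C_def[symmetric] using nz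
    by (simp add: divide_simps) algebra
  show ?thesis
    unfolding mob_def[of "c * mob \<beta> c"] 1 2 using nz nz5
    by (simp add: mob_def[of c] mob_def[of "mob \<beta> c"] C_def)
qed

section \<open>The conditions on the parameters of the extremal disk\<close>

text \<open>
  Put \<open>\<delta> = \<gamma> - \<alpha>\<close>, where \<open>\<gamma>\<close> is the convex combination.  The hypothesis becomes
  \<open>\<delta> = r * (1 - (cmod \<alpha>)\<^sup>2) - r * \<alpha> * cnj \<delta>\<close>; solving this real linear equation shows that \<open>\<delta>\<close>,
  hence \<open>\<beta> - \<alpha>\<close>, is a real multiple of \<open>1 - r * \<alpha>\<close>.  Geometrically \<open>\<alpha>\<close>, \<open>\<beta>\<close> and \<open>1 / r\<close> are
  collinear, and the conclusion records this with \<open>\<beta>\<close> as base point.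
\<close>

lemma collinear_from_mob:
  fixes r t :: real and \<alpha> \<beta> :: complex
  assumes r: "0 < r" "r < 1" and t: "0 < t" "t < 1" and ab: "cmod \<alpha> < 1" "cmod \<beta> < 1"
    and \<alpha>: "\<alpha> = mob (of_real t * \<alpha> + of_real (1 - t) * \<beta>) r"
  obtains k :: real where "k \<noteq> 0" "\<beta> - \<alpha> = k * (1 - r * \<beta>)"
proof -
  define \<gamma> \<delta> where "\<gamma> = of_real t * \<alpha> + of_real (1 - t) * \<beta>" and "\<delta> = \<gamma> - \<alpha>"
  define a where "a = (cmod \<alpha>)\<^sup>2"
  have a: "0 \<le> a" "a < 1" "\<alpha> * cnj \<alpha> = of_real a"
  proof -
    show "0 \<le> a" by (simp add: a_def)
    show "a < 1" using ab by (simp add: a_def abs_square_less_1)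
    show "\<alpha> * cnj \<alpha> = of_real a" unfolding a_def by (rule complex_norm_square[symmetric])
  qed
  have r2: "0 < r\<^sup>2" "r\<^sup>2 < 1" using r by (auto simp: abs_square_less_1)
  have "cmod \<gamma> \<le> t * cmod \<alpha> + (1 - t) * cmod \<beta>"
    unfolding \<gamma>_def using t norm_triangle_ineq[of "of_real t * \<alpha>" "of_real (1 - t) * \<beta>"]
    by (simp only: norm_mult norm_of_real)
  also have "\<dots> < t * 1 + (1 - t) * 1"
    using t ab by (intro add_strict_mono mult_strict_left_mono) auto
  finally have g: "cmod \<gamma> < 1" by simp
  have "1 - cnj \<gamma> * r \<noteq> 0" using g r cnj_mult_ne_1[of \<gamma> r] by simp
  moreover have "\<alpha> = (\<gamma> - r) / (1 - cnj \<gamma> * r)" using \<alpha> by (simp add: mob_def \<gamma>_def)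
  ultimately have "\<alpha> * (1 - cnj \<gamma> * r) = \<gamma> - r" by (simp add: field_simps)
  then have d: "\<delta> = r * (1 - a) - r * \<alpha> * cnj \<delta>"
    unfolding \<delta>_def by (simp add: algebra_simps a(3)[symmetric])
  then have "cnj \<delta> = cnj (r * (1 - a) - r * \<alpha> * cnj \<delta>)" by (rule arg_cong)
  then have "cnj \<delta> = r * (1 - a) - r * cnj \<alpha> * \<delta>" by simp
  with d have "\<delta> = r * (1 - a) - r * \<alpha> * (r * (1 - a) - r * cnj \<alpha> * \<delta>)" by simp
  also have "\<dots> = r * (1 - a) * (1 - r * \<alpha>) + r\<^sup>2 * (\<alpha> * cnj \<alpha>) * \<delta>"
    by (simp add: algebra_simps power2_eq_square)
  finally have "\<delta> * (1 - r\<^sup>2 * a) = r * (1 - a) * (1 - r * \<alpha>)"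
    unfolding a(3) by (simp add: algebra_simps)
  moreover have ra: "r\<^sup>2 * a < 1" using r2 a
    by (smt (verit) mult_left_le)
  then have ra': "1 - complex_of_real (r\<^sup>2 * a) \<noteq> 0"
    by (metis eq_iff_diff_eq_0 less_irrefl of_real_1 of_real_eq_iff)
  moreover define L where "L = r * (1 - a) / (1 - r\<^sup>2 * a)"
  ultimately have L: "\<delta> = of_real L * (1 - r * \<alpha>)"
    by (simp add: field_simps)
  define K where "K = L / (1 - t)"
  have "\<delta> = of_real (1 - t) * (\<beta> - \<alpha>)"
    by (simp add: \<delta>_def \<gamma>_def algebra_simps)
  moreover have "complex_of_real (1 - t) \<noteq> 0" using t by simp
  ultimately have "\<beta> - \<alpha> = \<delta> / of_real (1 - t)"
    by (metis nonzero_mult_div_cancel_left)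
  then have 1: "\<beta> - \<alpha> = of_real K * (1 - r * \<alpha>)" by (simp add: L K_def)
  then have 2: "1 - r * \<beta> = of_real (1 - r * K) * (1 - r * \<alpha>)"
    unfolding of_real_diff of_real_mult of_real_1 by algebra
  have "K \<noteq> 0" using r a ra t by (auto simp: K_def L_def)
  moreover have "1 - r * \<beta> \<noteq> 0" using cnj_mult_ne_1[of r \<beta>] r ab by simp
  with 2 have "1 - r * K \<noteq> 0" by (metis mult_zero_left of_real_0)
  moreover have "\<beta> - \<alpha> = of_real (K / (1 - r * K)) * (1 - r * \<beta>)"
  proof -
    have "K / (1 - r * K) * (1 - r * K) = K" using \<open>1 - r * K \<noteq> 0\<close> by simp
    then show ?thesis unfolding 1 2 by (simp only: mult.assoc[symmetric] of_real_mult[symmetric])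
  qed
  ultimately show ?thesis using that[of "K / (1 - r * K)"] by simp
qed

text \<open>
  Write \<open>b = mob \<beta> r\<close> and substitute \<open>\<alpha> = \<beta> - k * (1 - r * \<beta>)\<close>.  Squaring the modulus equation
  gives a quadratic equation for the real number \<open>k\<close> without constant term, so it determines the
  nonzero \<open>k\<close>.  The complex equation \<open>mob b \<alpha> = r\<close> reduces to the same linear equation for
  \<open>k\<close>, because the numerator of \<open>mob b \<alpha>\<close> is real up to the factor \<open>1 - cnj \<beta> * r\<close>.
\<close>

lemma mob_mob_eq_of_cmod_eq:
  fixes r k :: real and \<alpha> \<beta> :: complex
  assumes r: "0 < r" "r < 1" and ab: "cmod \<alpha> < 1" "cmod \<beta> < 1"
    and k: "k \<noteq> 0" "\<beta> - \<alpha> = k * (1 - r * \<beta>)"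
    and m: "cmod (mob (mob \<beta> r) \<alpha>) = r"
  shows "mob (mob \<beta> r) \<alpha> = r"
proof -
  define b B where "b = mob \<beta> r" and "B = cnj \<beta>"
  define x E F where "x = Re \<beta>" and "E = (cmod (1 - r * \<beta>))\<^sup>2" and "F = 1 - (cmod \<beta>)\<^sup>2"
  have nz: "1 - r * \<beta> \<noteq> 0" "1 - B * r \<noteq> 0"
    using cnj_mult_ne_1[of r \<beta>] cnj_mult_ne_1[of \<beta> r] r ab by (auto simp: B_def)
  have b1: "cmod b < 1" unfolding b_def using r ab mob_in_disk by simp
  have nzb: "1 - cnj b * \<alpha> \<noteq> 0" using cnj_mult_ne_1 b1 ab by simp
  have Ec: "complex_of_real E = (1 - r * \<beta>) * (1 - B * r)"
    unfolding E_def complex_norm_square by (simp add: B_def mult.commute)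
  have Fc: "complex_of_real F = 1 - \<beta> * B"
    unfolding F_def of_real_diff complex_norm_square by (simp add: B_def)
  have \<alpha>: "\<alpha> = \<beta> - k * (1 - r * \<beta>)" using k(2) by (simp add: algebra_simps)
  have bb: "b * (1 - B * r) = \<beta> - r" using nz by (simp add: b_def mob_def B_def)
  have cb: "cnj b * (1 - r * \<beta>) = B - r" using arg_cong[OF bb, of cnj] by (simp add: B_def mult.commute)
  have 1: "(1 - B * r) * (b - \<alpha>) = of_real (k * E - r * F)"
    unfolding of_real_diff of_real_mult Ec Fc using bb \<alpha> by algebra
  have 2: "(1 - r * \<beta>) * (1 - cnj b * \<alpha>) = of_real F + k * ((B - r) * (1 - r * \<beta>))"
    unfolding Fc using cb \<alpha> by algebra
  have cm: "cmod (b - \<alpha>) = r * cmod (1 - cnj b * \<alpha>)"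
  proof -
    have "cmod (b - \<alpha>) / cmod (1 - cnj b * \<alpha>) = r"
      using m unfolding b_def[symmetric] mob_def[of b] norm_divide .
    moreover have "cmod (1 - cnj b * \<alpha>) \<noteq> 0" using nzb by simp
    ultimately show ?thesis by (metis nonzero_divide_eq_eq)
  qed
  have e: "cmod (1 - B * r) = cmod (1 - r * \<beta>)"
    by (metis B_def complex_cnj_complex_of_real complex_cnj_diff complex_cnj_mult complex_cnj_one complex_mod_cnj mult.commute)
  have "cmod ((1 - B * r) * (b - \<alpha>)) = r * cmod ((1 - r * \<beta>) * (1 - cnj b * \<alpha>))"
    by (simp add: norm_mult cm e)
  then have "(k * E - r * F)\<^sup>2 = r\<^sup>2 * (cmod (of_real F + k * ((B - r) * (1 - r * \<beta>))))\<^sup>2"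
    unfolding 1 2 by (metis norm_of_real power2_abs power_mult_distrib)
  also have "(cmod (of_real F + k * ((B - r) * (1 - r * \<beta>))))\<^sup>2
      = F\<^sup>2 + 2 * k * F * Re ((B - r) * (1 - r * \<beta>)) + k\<^sup>2 * (cmod (B - r))\<^sup>2 * E"
    unfolding E_def cmod_power2 by (simp add: power2_eq_square algebra_simps)
  finally have 3: "k * (k * E\<^sup>2 - 2 * r * E * F)
      = k * (r\<^sup>2 * (2 * F * Re ((B - r) * (1 - r * \<beta>)) + k * (cmod (B - r))\<^sup>2 * E))"
    by (simp add: power2_eq_square algebra_simps)
  have Ex: "E = 1 - 2 * r * x + r\<^sup>2 * (x\<^sup>2 + (Im \<beta>)\<^sup>2)"
    unfolding E_def cmod_power2 by (simp add: x_def power2_eq_square algebra_simps)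
  have Bx: "(cmod (B - r))\<^sup>2 = x\<^sup>2 - 2 * r * x + r\<^sup>2 + (Im \<beta>)\<^sup>2"
    unfolding B_def cmod_power2 by (simp add: x_def power2_eq_square algebra_simps)
  have Rx: "Re ((B - r) * (1 - r * \<beta>)) = x - r - r * (x\<^sup>2 + (Im \<beta>)\<^sup>2) + r\<^sup>2 * x"
    unfolding B_def by (simp add: x_def power2_eq_square algebra_simps)
  from 3 k(1) have "k * E\<^sup>2 - 2 * r * E * F
      = r\<^sup>2 * (2 * F * Re ((B - r) * (1 - r * \<beta>)) + k * (cmod (B - r))\<^sup>2 * E)" by simp
  then have e1: "k * E * (E - r\<^sup>2 * (cmod (B - r))\<^sup>2)
      = 2 * r * F * (E + r * Re ((B - r) * (1 - r * \<beta>)))"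
    by (simp add: algebra_simps power2_eq_square)
  have e2: "E - r\<^sup>2 * (cmod (B - r))\<^sup>2 = (1 - r\<^sup>2) * (1 + r\<^sup>2 - 2 * r * x)"
    unfolding Ex Bx by (simp add: algebra_simps power2_eq_square)
  have e3: "E + r * Re ((B - r) * (1 - r * \<beta>)) = (1 - r\<^sup>2) * (1 - r * x)"
    unfolding Ex Rx by (simp add: algebra_simps power2_eq_square)
  have "(1 - r\<^sup>2) * (k * E * (1 + r\<^sup>2 - 2 * r * x)) = (1 - r\<^sup>2) * (2 * r * F * (1 - r * x))"
    using e1 unfolding e2 e3 by (simp only: mult_ac)
  moreover have "1 - r\<^sup>2 \<noteq> 0" using r by (simp add: power2_eq_1_iff)
  ultimately have "k * E * (1 + r\<^sup>2 - 2 * r * x) = 2 * r * F * (1 - r * x)" by simp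
  then have "complex_of_real (k * E * (1 + r\<^sup>2 - 2 * r * x)) = of_real (2 * r * F * (1 - r * x))"
    by simp
  then have "of_real k * of_real E * (1 + (of_real r)\<^sup>2 - of_real r * (2 * complex_of_real x))
      = of_real r * of_real F * (2 - of_real r * (2 * complex_of_real x))"
    by (simp only: of_real_mult of_real_add of_real_diff of_real_power of_real_1 of_real_numeral)
      (simp only: algebra_simps mult_1_left)
  moreover have "2 * complex_of_real x = \<beta> + B"
    by (simp add: complex_eq_iff x_def B_def)
  ultimately have 4: "of_real k * of_real E * (1 + (of_real r)\<^sup>2 - r * (\<beta> + B)) = of_real r * of_real F * (2 - r * (\<beta> + B))"
    by (simp only:)
  have "(1 - r * \<beta>) * of_real (k * E - r * F) - r * ((1 - B * r) * (of_real F + k * ((B - r) * (1 - r * \<beta>))))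
     = of_real k * of_real E * (1 + (of_real r)\<^sup>2 - r * (\<beta> + B)) - of_real r * of_real F * (2 - r * (\<beta> + B))
      + r * k * (B - r) * (of_real E - (1 - r * \<beta>) * (1 - B * r))"
    unfolding of_real_diff of_real_mult by (simp only: algebra_simps power2_eq_square) simp
  also have "\<dots> = 0" unfolding 4 unfolding Ec by simp
  finally have "(1 - r * \<beta>) * ((1 - B * r) * (b - \<alpha>)) = r * ((1 - B * r) * ((1 - r * \<beta>) * (1 - cnj b * \<alpha>)))"
    unfolding 1 2 by simp
  then have "((1 - r * \<beta>) * (1 - B * r)) * (b - \<alpha>) = ((1 - r * \<beta>) * (1 - B * r)) * (r * (1 - cnj b * \<alpha>))"
    by (simp only: mult_ac)
  then have "b - \<alpha> = r * (1 - cnj b * \<alpha>)" using nz by simp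
  then have "mob b \<alpha> = r" unfolding mob_def[of b] using nzb by simp
  then show ?thesis by (simp only: b_def)
qed

text \<open>
  The data of the extremal disk in the coordinates where \<open>c\<close> is the positive number \<open>r\<close>.  Applying
  \<open>mob z\<close> to the last hypothesis and factoring the result by \<open>mob_blaschke\<close> gives
  \<open>p = u * mob r \<alpha> * mob (mob \<beta> r) \<alpha>\<close>.  Comparing moduli with the hypothesis on \<open>p\<close>
  yields \<open>cmod (mob (mob \<beta> r) \<alpha>) = r\<close>; this is the point where the equality \<open>p = q\<close> enters.
\<close>

lemma disk_core:
  fixes r t p :: real and \<alpha> \<beta> u z :: complex
  assumes r: "0 < r" "r < 1" and t: "0 < t" "t < 1" and ab: "cmod \<alpha> < 1" "cmod \<beta> < 1"
    and \<alpha>: "\<alpha> = mob (of_real t * \<alpha> + of_real (1 - t) * \<beta>) r"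
    and p: "cmod (r * mob \<alpha> r) = p" "0 < p" "p < 1"
    and u: "cmod u = 1" "z = u * (r * mob \<beta> r)" "u * (\<alpha> * mob \<beta> \<alpha>) = mob z p"
  shows "\<alpha> = mob (mob \<beta> r) r" "of_real p = u * (r * mob r \<alpha>)"
proof -
  define b where "b = mob \<beta> r"
  have b: "cmod b < 1" unfolding b_def using r ab mob_in_disk by simp
  have z: "cmod z < 1" unfolding u(2) b_def[symmetric] using u(1) r b
    by (simp add: norm_mult) (smt (verit) mult_left_le norm_ge_zero)
  have "of_real p = mob z (mob z p)" using z p mob_mob by simp
  also have "\<dots> = mob (u * (r * mob \<beta> r)) (u * (\<alpha> * mob \<beta> \<alpha>))" using u by simp
  also have "\<dots> = u * (mob r \<alpha> * mob b \<alpha>)"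
    using mob_rotate[OF u(1)] mob_blaschke[of r \<beta> \<alpha>] r ab by (simp add: b_def)
  finally have 1: "of_real p = u * (mob r \<alpha> * mob b \<alpha>)" .
  then have "p = cmod (mob r \<alpha>) * cmod (mob b \<alpha>)"
    by (metis abs_of_pos norm_mult norm_of_real p(2) u(1) mult_1)
  moreover have "p = r * cmod (mob r \<alpha>)" using p(1) r cmod_mob_commute by (simp add: norm_mult)
  ultimately have "cmod (mob b \<alpha>) = r" using p(2) by (metis mult.commute mult_cancel_left less_irrefl mult_zero_left)
  moreover obtain k :: real where "k \<noteq> 0" "\<beta> - \<alpha> = k * (1 - r * \<beta>)"
    using collinear_from_mob[OF r t ab \<alpha>] by blast
  ultimately have 2: "mob b \<alpha> = r" using mob_mob_eq_of_cmod_eq[OF r ab] unfolding b_def by blast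
  then show "\<alpha> = mob (mob \<beta> r) r" using mob_mob[OF b ab(1)] by (simp add: b_def)
  show "of_real p = u * (r * mob r \<alpha>)" using 1 2 by (simp add: mult.commute)
qed

section \<open>The quartic equation and the quotient along the disk\<close>

text \<open>
  With \<open>N\<close>, \<open>M\<close> and \<open>M'\<close> as in the proof, the formula for \<open>p\<close> reads \<open>p * N = u * r * M\<close>, and its
  conjugate reads \<open>p * N = cnj u * r * M'\<close>.  Using the one or the other in each of the
  four terms containing \<open>p\<close> turns \<open>N\<close> times the quartic into \<open>u\<^sup>2 * r\<close> times a polynomial
  in \<open>r\<close>, \<open>b\<close>, \<open>cnj b\<close> that vanishes identically.
\<close>

lemma quartic_of_core:
  fixes r p :: real and \<alpha> b u z :: complex
  assumes r: "0 < r" "r < 1" and b: "cmod b < 1" and u: "cmod u = 1"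
    and \<alpha>: "\<alpha> = mob b r" and p: "of_real p = u * (r * mob r \<alpha>)" and z: "z = u * (r * b)"
  shows "cnj z * p * u ^ 4 - cnj z * u ^ 3 - p * u ^ 3 + p * u - p * z + u * z = 0"
proof -
  define B U where "B = cnj b" and "U = cnj u"
  define N M M' where "N = 1 + (of_real r)\<^sup>2 - of_real r * (b + B)" and "M = 2 * of_real r - b - B * (of_real r)\<^sup>2"
    and "M' = 2 * of_real r - B - b * (of_real r)\<^sup>2"
  have uU: "u * U = 1" unfolding U_def using u by (simp add: complex_norm_square[symmetric])
  have \<alpha>1: "cmod \<alpha> < 1" unfolding \<alpha> using r b mob_in_disk by simp
  have nz: "1 - B * r \<noteq> 0" "1 - r * \<alpha> \<noteq> 0"
    using cnj_mult_ne_1[of r \<alpha>] cnj_mult_ne_1[of b r] r b \<alpha>1 by (auto simp: B_def)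
  have \<alpha>B: "\<alpha> * (1 - B * r) = b - r" using nz by (simp add: \<alpha> mob_def B_def)
  have NB: "N = (1 - r * \<alpha>) * (1 - B * r)" and MB: "M = (r - \<alpha>) * (1 - B * r)"
    unfolding N_def M_def using \<alpha>B by algebra+
  have N0: "N \<noteq> 0" using NB nz by simp
  have 1: "p * N = u * r * M"
    unfolding p NB MB using nz by (simp add: mob_def[of r])
  have "cnj (p * N) = cnj (u * r * M)" using 1 by simp
  then have 2: "p * N = U * r * M'"
    by (simp add: N_def M_def M'_def B_def U_def algebra_simps)
  have z': "cnj z = U * r * B" by (simp add: z B_def U_def)
  have "N * (cnj z * p * u ^ 4 - cnj z * u ^ 3 - p * u ^ 3 + p * u - p * z + u * z)
      = u\<^sup>2 * r * (r * B * M' - B * N - M' + M - r * b * M + b * N)"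
    unfolding z' unfolding z using 1 2 uU by algebra
  also have "\<dots> = 0"
    unfolding N_def M_def M'_def by algebra
  finally show ?thesis using N0 by simp
qed

text \<open>
  In the variables \<open>X = cnj u * z1\<close> and \<open>Y = cnj u * z2\<close> the denominators of the two components of
  the disk are \<open>E\<close> and \<open>F\<close>.  Clearing them, numerator and denominator of \<open>sym_quot\<close> become quartic
  polynomials in \<open>\<mu>\<close> with the common factor \<open>S\<close>.
\<close>

lemma sym_quot_of_core:
  fixes r p :: real and \<alpha> b u z \<mu> v z1 z2 :: complex
  assumes r: "0 < r" "r < 1" and b: "cmod b < 1" and u: "cmod u = 1" and \<mu>: "cmod \<mu> < 1"
    and \<alpha>: "\<alpha> = mob b r" and p: "of_real p = u * (r * mob r \<alpha>)" "p \<noteq> 0"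
    and v: "of_real p = v * (r * mob \<alpha> r)" and z1: "z1 = v * (\<mu> * mob \<alpha> \<mu>)"
    and z2: "z2 = u * (mob r \<mu> * mob b \<mu>)"
    and den: "(z1 + z2) * (cnj u)\<^sup>2 - p * z1 * z2 * (cnj u)\<^sup>2 - 2 * cnj u + p \<noteq> 0"
  shows "sym_quot p z1 z2 (cnj u) = cmod (mob r \<mu>) * cmod (mob \<alpha> \<mu>)"
proof -
  define B U where "B = cnj b" and "U = cnj u"
  define N M M' where "N = 1 + (of_real r)\<^sup>2 - of_real r * (b + B)" and "M = 2 * of_real r - b - B * (of_real r)\<^sup>2"
    and "M' = 2 * of_real r - B - b * (of_real r)\<^sup>2"
  define E F A where "E = 1 - b * r - B * \<mu> + r * \<mu>" and "F = (1 - r * \<mu>) * (1 - B * \<mu>)"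
    and "A = b - r - \<mu> + B * r * \<mu>"
  have uU: "u * U = 1" unfolding U_def using u by (simp add: complex_norm_square[symmetric])
  have \<alpha>1: "cmod \<alpha> < 1" unfolding \<alpha> using r b mob_in_disk by simp
  have nz: "1 - B * r \<noteq> 0" "1 - r * \<alpha> \<noteq> 0" "1 - b * r \<noteq> 0" "1 - r * \<mu> \<noteq> 0" "1 - B * \<mu> \<noteq> 0"
     "1 - cnj \<alpha> * \<mu> \<noteq> 0" "1 - cnj \<alpha> * r \<noteq> 0"
    using cnj_mult_ne_1[of r \<alpha>] cnj_mult_ne_1[of b r] cnj_mult_ne_1[of r b] cnj_mult_ne_1[of r \<mu>]
      cnj_mult_ne_1[of b \<mu>] cnj_mult_ne_1[of \<alpha> \<mu>] cnj_mult_ne_1[of \<alpha> r] r b \<alpha>1 \<mu>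
    by (auto simp: B_def mult.commute)
  have \<alpha>B: "\<alpha> * (1 - B * r) = b - r" using nz by (simp add: \<alpha> mob_def B_def)
  have \<alpha>b: "cnj \<alpha> * (1 - b * r) = B - r" using arg_cong[OF \<alpha>B, of cnj] by (simp add: B_def)
  have NB: "N = (1 - r * \<alpha>) * (1 - B * r)" and MB: "M = (r - \<alpha>) * (1 - B * r)"
    unfolding N_def M_def using \<alpha>B by algebra+
  have Nb: "N = (1 - cnj \<alpha> * r) * (1 - b * r)" unfolding N_def using \<alpha>b by algebra
  have AB: "A = (\<alpha> - \<mu>) * (1 - B * r)" and Eb: "E = (1 - cnj \<alpha> * \<mu>) * (1 - b * r)"
    unfolding A_def E_def using \<alpha>B \<alpha>b by algebra+
  have nz2: "N \<noteq> 0" "E \<noteq> 0" "F \<noteq> 0" using NB Eb nz by (simp_all add: F_def)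
  have 1: "p * N = u * r * M"
    unfolding p NB MB using nz by (simp add: mob_def[of r])
  have "cnj (p * N) = cnj (u * r * M)" using 1 by simp
  then have 2: "p * N = U * r * M'"
    by (simp add: N_def M_def M'_def B_def U_def algebra_simps)
  have M0: "M \<noteq> 0" using 1 p(2) nz2 by auto
  have "p * ((1 - cnj \<alpha> * r) * (1 - B * r)) = - v * r * M"
  proof -
    have "mob \<alpha> r * (1 - cnj \<alpha> * r) = \<alpha> - r" using nz by (simp add: mob_def)
    then show ?thesis unfolding v MB by algebra
  qed
  then have "(1 - B * r) * (p * N) = - v * r * M * (1 - b * r)"
    unfolding Nb by algebra
  then have "(r * M) * (v * (1 - b * r)) = (r * M) * (- u * (1 - B * r))"
    unfolding 1 by (simp add: algebra_simps)
  moreover have "r * M \<noteq> 0" using M0 r by simp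
  ultimately have v': "v * (1 - b * r) = - u * (1 - B * r)" using mult_left_cancel by blast
  define X Y where "X = U * z1" and "Y = U * z2"
  have X: "X * E = - \<mu> * A"
  proof -
    have "X * E = U * (v * (1 - b * r)) * \<mu> * (\<alpha> - \<mu>)"
      unfolding X_def z1 Eb using nz by (simp add: mob_def[of \<alpha>])
    then show ?thesis unfolding v' AB using uU by algebra
  qed
  have Y: "Y * F = (r - \<mu>) * (b - \<mu>)"
  proof -
    have "Y * F = (u * U) * ((mob r \<mu> * (1 - r * \<mu>)) * (mob b \<mu> * (1 - B * \<mu>)))"
      unfolding Y_def z2 F_def by (simp add: mult_ac)
    then show ?thesis unfolding uU using nz by (simp add: mob_def B_def)
  qed
  have z12: "z1 = u * X" "z2 = u * Y" unfolding X_def Y_def using uU by algebra+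
  define n d where "n = p * z1 * z2 * U\<^sup>2 - 2 * z1 * z2 * U + (z1 + z2) - p"
    and "d = (z1 + z2) * U\<^sup>2 - p * z1 * z2 * U\<^sup>2 - 2 * U + p"
  have n: "N * n = u * (r * M * X * Y - 2 * N * X * Y + N * (X + Y) - r * M)"
    unfolding n_def z12 using uU 1 by algebra
  have d: "N * d = U * (N * (X + Y) - r * M' * X * Y - 2 * N + r * M')"
    unfolding d_def z12 using uU 2 by algebra
  \<comment> \<open>The common factor \<open>S\<close> vanishes at the two boundary points that the disk sends to the
    torus point \<open>(u, u)\<close>, where numerator and denominator both vanish.\<close>
  define S where "S = (1 - B * r) * \<mu>\<^sup>2 + (B - b) * \<mu> - (1 - b * r)"
  have n': "N * n * (E * F) = - u * (2 - r * (b + B)) * S * ((r - \<mu>) * A)"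
  proof -
    have "N * n * (E * F) = u * ((r * M - 2 * N) * (X * E) * (Y * F) + N * ((X * E) * F + (Y * F) * E) - r * M * E * F)"
      unfolding n by (simp add: algebra_simps)
    also have "\<dots> = - u * (2 - r * (b + B)) * S * ((r - \<mu>) * A)"
      unfolding X Y unfolding S_def N_def M_def E_def F_def A_def by algebra
    finally show ?thesis .
  qed
  have d': "N * d * (E * F) = U * (2 - r * (b + B)) * S * ((1 - r * \<mu>) * E)"
  proof -
    have "N * d * (E * F) = U * (N * ((X * E) * F + (Y * F) * E) - r * M' * (X * E) * (Y * F) - 2 * N * E * F + r * M' * E * F)"
      unfolding d by (simp add: algebra_simps)
    also have "\<dots> = U * (2 - r * (b + B)) * S * ((1 - r * \<mu>) * E)"
      unfolding X Y unfolding S_def N_def M'_def E_def F_def A_def by algebra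
    finally show ?thesis .
  qed
  have d0: "d \<noteq> 0" using den by (simp add: d_def U_def)
  have "(N * E * F) * (n * ((1 - r * \<mu>) * E)) = (N * E * F) * (- u\<^sup>2 * d * ((r - \<mu>) * A))"
    using n' d' uU by algebra
  moreover have "N * E * F \<noteq> 0" using nz2 by simp
  ultimately have "n * ((1 - r * \<mu>) * E) = - u\<^sup>2 * d * ((r - \<mu>) * A)"
    using mult_left_cancel by blast
  then have "n / d = - u\<^sup>2 * (((r - \<mu>) / (1 - r * \<mu>)) * (A / E))"
    using d0 nz nz2 by (simp add: field_simps)
  then have "cmod (n / d) = cmod (mob r \<mu>) * cmod (A / E)"
    by (simp only: norm_mult norm_power norm_minus_cancel u) (simp add: mob_def)
  also have "A / E = mob \<alpha> \<mu> * ((1 - B * r) / (1 - b * r))"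
    unfolding AB Eb mob_def using nz by simp
  also have "cmod \<dots> = cmod (mob \<alpha> \<mu>)"
  proof -
    have "cnj (1 - B * r) = 1 - b * r" by (simp add: B_def)
    then have "cmod (1 - B * r) = cmod (1 - b * r)" by (metis complex_mod_cnj)
    then show ?thesis using nz by (simp add: norm_mult norm_divide)
  qed
  finally show ?thesis by (simp add: sym_quot_def n_def d_def U_def)
qed

section \<open>Mean values of the logarithm of a modulus\<close>

lemma riemann_sum_bound:
  fixes F :: "real \<Rightarrow> real"
  assumes d: "0 \<le> d" and F: "continuous_on {0..of_nat N * d} F"
    and osc: "\<And>k s. k < N \<Longrightarrow> of_nat k * d \<le> s \<Longrightarrow> s \<le> of_nat (Suc k) * d \<Longrightarrow> \<bar>F s - F (of_nat k * d)\<bar> \<le> e"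
  shows "\<bar>integral {0..of_nat N * d} F - d * (\<Sum>k<N. F (of_nat k * d))\<bar> \<le> of_nat N * d * e"
  using F osc
proof (induction N)
  case 0
  show ?case by simp
next
  case (Suc N)
  let ?a = "of_nat N * d" and ?b = "of_nat (Suc N) * d"
  have ab: "0 \<le> ?a" "?a \<le> ?b" using d by (auto simp: mult_right_mono)
  have c: "continuous_on {?a..?b} F" "continuous_on {0..?a} F"
    using Suc.prems(1) ab by (auto elim!: continuous_on_subset)
  have IH: "\<bar>integral {0..?a} F - d * (\<Sum>k<N. F (of_nat k * d))\<bar> \<le> of_nat N * d * e"
    using Suc.prems(2) by (intro Suc.IH c) auto
  have 1: "integral {0..?b} F = integral {0..?a} F + integral {?a..?b} F"
    using Henstock_Kurzweil_Integration.integral_combine[OF ab integrable_continuous_real[OF Suc.prems(1)]] by simp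
  have "integral {?a..?b} F - d * F ?a = integral {?a..?b} (\<lambda>s. F s - F ?a)"
    using c ab by (subst Henstock_Kurzweil_Integration.integral_diff)
       (auto intro: integrable_continuous_real simp: algebra_simps)
  also have "\<bar>\<dots>\<bar> \<le> e * (?b - ?a)"
  proof -
    have "norm (integral {?a..?b} (\<lambda>s. F s - F ?a)) \<le> e * (?b - ?a)"
      using Suc.prems(2)[of N] ab
      by (intro integral_bound continuous_intros c) auto
    then show ?thesis by simp
  qed
  finally have 2: "\<bar>integral {?a..?b} F - d * F ?a\<bar> \<le> d * e" by (simp add: algebra_simps)
  show ?case
    using IH 2 unfolding 1 by (simp add: algebra_simps abs_if split: if_splits)
qed

lemma integral_periodic_shift:
  fixes g :: "real \<Rightarrow> real"
  assumes g: "continuous_on UNIV g" and per: "\<And>x. g (x + c) = g x" and \<phi>: "0 \<le> \<phi>" "\<phi> \<le> c"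
  shows "integral {0..c} (\<lambda>s. g (\<phi> + s)) = integral {0..c} g"
proof -
  have ii: "g integrable_on {a..b}" for a b
    by (intro integrable_continuous_real continuous_on_subset[OF g]) auto
  have sh: "integral {a..b} (\<lambda>s. g (s + x)) = integral {a+x..b+x} g" for a b x
    using integral_shift_real_ivl[of "a+x" x "b+x" g] by simp
  have "integral {0..c} (\<lambda>s. g (\<phi> + s)) = integral {\<phi>..c+\<phi>} g"
    using sh[of 0 c \<phi>] by (simp add: add.commute)
  also have "\<dots> = integral {\<phi>..c} g + integral {c..c+\<phi>} g"
    using \<phi> by (intro Henstock_Kurzweil_Integration.integral_combine[symmetric] ii) auto
  also have "integral {c..c+\<phi>} g = integral {0..\<phi>} (\<lambda>s. g (s + c))"
    using sh[of 0 \<phi> c] by (simp add: add.commute)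
  also have "\<dots> = integral {0..\<phi>} g" by (simp add: per)
  also have "integral {\<phi>..c} g + integral {0..\<phi>} g = integral {0..c} g"
    using Henstock_Kurzweil_Integration.integral_combine[OF \<phi> ii] by simp
  finally show ?thesis .
qed

text \<open>
  Jensen's inequality for a continuous majorant \<open>g\<close> of \<open>ln (cmod (h w))\<close> on the circle, by a route
  that never looks at the zeros of \<open>h\<close>.  The product \<open>H\<close> of the \<open>N\<close> rotations of \<open>h\<close> by \<open>N\<close>-th
  roots of unity satisfies \<open>H 0 = h 0 ^ N\<close>, and the maximum modulus principle bounds it by the
  exponential of a sum of values of \<open>g\<close> at equidistant points.  Divided by \<open>N\<close>, these sums
  converge to the mean of \<open>g\<close>, uniformly in the starting point.
\<close>

lemma norm_center_le_exp_mean: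
  fixes h :: "complex \<Rightarrow> complex" and g :: "real \<Rightarrow> real"
  assumes h: "h holomorphic_on ball 0 1" "continuous_on (cball 0 1) h"
    and g: "continuous_on UNIV g" "\<And>x. g (x + 2 * pi) = g x"
    and le: "\<And>x. cmod (h (cis x)) \<le> exp (g x)"
  shows "cmod (h 0) \<le> exp (integral {0..2*pi} g / (2*pi))"
proof -
  define I where "I = integral {0..2*pi} g"
  have "cmod (h 0) \<le> exp (I / (2*pi) + e)" if e: "e > 0" for e
  proof -
    have "uniformly_continuous_on {0..4*pi} g"
      by (intro compact_uniformly_continuous continuous_on_subset[OF g(1)]) auto
    then obtain \<delta> where \<delta>: "\<delta> > 0" and uc: "\<And>x y. x \<in> {0..4*pi} \<Longrightarrow> y \<in> {0..4*pi} \<Longrightarrow> dist x y < \<delta> \<Longrightarrow> dist (g x) (g y) < e"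
      using e unfolding uniformly_continuous_on_def by metis
    obtain N :: nat where N: "2 * pi / \<delta> < N" using reals_Archimedean2 by blast
    have N0: "N > 0" using N \<delta> by (cases N) (auto simp: divide_less_0_iff)
    define d where "d = 2 * pi / N"
    have d: "0 < d" "d < \<delta>" "N * d = 2 * pi" using N N0 \<delta> by (auto simp: d_def field_simps)
    have sum: "(\<Sum>k<N. g (\<phi> + of_nat k * d)) \<le> N * (I / (2*pi) + e)" if \<phi>: "0 \<le> \<phi>" "\<phi> \<le> 2 * pi" for \<phi>
    proof -
      have "\<bar>integral {0..of_nat N * d} (\<lambda>s. g (\<phi> + s)) - d * (\<Sum>k<N. g (\<phi> + of_nat k * d))\<bar> \<le> of_nat N * d * e"
      proof (rule riemann_sum_bound)
        show "continuous_on {0..of_nat N * d} (\<lambda>s. g (\<phi> + s))"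
          by (intro continuous_on_compose2[OF g(1)] continuous_intros) auto
        fix k s assume k: "k < N" and s: "of_nat k * d \<le> s" "s \<le> of_nat (Suc k) * d"
        have "of_nat (Suc k) * d \<le> N * d" using k d by (intro mult_right_mono) auto
        moreover have "0 \<le> of_nat k * d" using d by simp
        ultimately have "\<phi> + s \<in> {0..4*pi}" "\<phi> + of_nat k * d \<in> {0..4*pi}"
          using s d \<phi> unfolding d(3) atLeastAtMost_iff by linarith+
        moreover have "dist (\<phi> + s) (\<phi> + of_nat k * d) < \<delta>"
          using s d by (auto simp: dist_real_def algebra_simps)
        ultimately show "\<bar>g (\<phi> + s) - g (\<phi> + of_nat k * d)\<bar> \<le> e"
          using uc[of "\<phi> + s" "\<phi> + of_nat k * d"] by (simp add: dist_real_def)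
      qed (use d in auto)
      then have "d * (\<Sum>k<N. g (\<phi> + of_nat k * d)) \<le> I + 2 * pi * e"
        unfolding d(3) integral_periodic_shift[OF g \<phi>] I_def[symmetric] by linarith
      then show ?thesis using N0 by (simp add: d_def field_simps)
    qed
    define H where "H w = (\<Prod>k<N. h (w * cis (of_nat k * d)))" for w
    have "norm (H 0) \<le> exp (N * (I / (2*pi) + e))"
    proof (rule maximum_modulus_frontier[of H "cball 0 1"])
      have "(\<lambda>w. h (w * cis (of_nat k * d))) holomorphic_on ball 0 1" for k
        by (rule holomorphic_on_compose_gen[of "\<lambda>w. w * cis (of_nat k * d)" "ball 0 1" h "ball 0 1", unfolded comp_def])
          (auto simp: norm_mult intro!: holomorphic_intros h(1))
      then show "H holomorphic_on interior (cball 0 1)"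
        unfolding H_def by (auto intro!: holomorphic_intros)
      have "continuous_on (cball 0 1) (\<lambda>w. h (w * cis (of_nat k * d)))" for k
        by (intro continuous_on_compose2[OF h(2)] continuous_intros) (auto simp: norm_mult)
      then show "continuous_on (closure (cball 0 1)) H"
        unfolding H_def by (auto intro!: continuous_intros)
      fix w :: complex assume "w \<in> frontier (cball 0 1)"
      then have w: "cmod w = 1" by (simp add: frontier_cball)
      then obtain \<phi> where \<phi>: "0 \<le> \<phi>" "\<phi> \<le> 2 * pi" "w = cis \<phi>"
        using Arg2pi_ge_0[of w] Arg2pi_lt_2pi[of w] complex_norm_eq_1_exp[of w]
        by (metis cis_conv_exp less_imp_le mult.commute)
      have "norm (H w) = (\<Prod>k<N. cmod (h (cis (\<phi> + of_nat k * d))))"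
        by (simp add: H_def prod_norm \<phi>(3) cis_mult)
      also have "\<dots> \<le> (\<Prod>k<N. exp (g (\<phi> + of_nat k * d)))"
        by (intro prod_mono) (auto simp: le)
      also have "\<dots> = exp (\<Sum>k<N. g (\<phi> + of_nat k * d))" by (simp add: exp_sum)
      also have "\<dots> \<le> exp (N * (I / (2*pi) + e))" using sum[OF \<phi>(1,2)] by simp
      finally show "norm (H w) \<le> exp (N * (I / (2*pi) + e))" .
    qed auto
    then have "cmod (h 0) ^ N \<le> exp (I / (2*pi) + e) ^ N"
      by (simp add: H_def norm_power exp_of_nat_mult)
    then show ?thesis
      using N0 power_mono_iff[of "cmod (h 0)" "exp (I / (2*pi) + e)" N] by simp
  qed
  then have "cmod (h 0) \<le> exp (I / (2*pi)) * exp e" if "e > 0" for e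
    using that by (simp only: exp_add)
  then have "cmod (h 0) * exp (- (I / (2*pi))) \<le> exp e" if "e > 0" for e
    unfolding exp_minus divide_inverse[symmetric]
    using that pos_divide_le_eq[OF exp_gt_zero] by (simp add: mult.commute)
  moreover have "((\<lambda>e::real. exp e) \<longlongrightarrow> exp 0) (at_right 0)"
    by (intro tendsto_intros)
  ultimately have "cmod (h 0) * exp (- (I / (2*pi))) \<le> 1"
    by (intro tendsto_lowerbound[of exp _ "at_right (0::real)"])
       (auto simp: eventually_at_filter)
  then show ?thesis unfolding I_def by (simp add: exp_minus field_simps)
qed

text \<open>
  For a zero-free function the preceding inequality applies to \<open>h\<close> and to \<open>1 / h\<close>.
\<close>

lemma mean_ln_norm_eq:
  fixes h :: "complex \<Rightarrow> complex"
  assumes h: "h holomorphic_on ball 0 1" "continuous_on (cball 0 1) h"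
    and nz: "\<And>w. w \<in> cball 0 1 \<Longrightarrow> h w \<noteq> 0"
  shows "integral {0..2*pi} (\<lambda>x. ln (cmod (h (cis x)))) / (2*pi) = ln (cmod (h 0))"
proof -
  let ?g = "\<lambda>x. ln (cmod (h (cis x)))"
  have cg: "continuous_on UNIV ?g"
    using nz by (intro continuous_intros continuous_on_compose2[OF h(2)]) auto
  have per: "?g (x + 2 * pi) = ?g x" for x
    by (simp add: cis.ctr)
  have pos: "cmod (h w) > 0" if "cmod w \<le> 1" for w using nz that by simp
  have "cmod (h 0) \<le> exp (integral {0..2*pi} ?g / (2*pi))"
    using pos by (intro norm_center_le_exp_mean h cg per) simp
  then have 1: "ln (cmod (h 0)) \<le> integral {0..2*pi} ?g / (2*pi)"
    using pos[of 0] ln_le_cancel_iff[of "cmod (h 0)" "exp (integral {0..2*pi} ?g / (2*pi))"] by simp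
  have "cmod (inverse (h 0)) \<le> exp (integral {0..2*pi} (\<lambda>x. - ?g x) / (2*pi))"
  proof (rule norm_center_le_exp_mean[of "\<lambda>w. inverse (h w)"])
    show "(\<lambda>w. inverse (h w)) holomorphic_on ball 0 1" using nz by (intro holomorphic_intros h) auto
    show "continuous_on (cball 0 1) (\<lambda>w. inverse (h w))" using nz by (intro continuous_intros h) auto
    show "continuous_on UNIV (\<lambda>x. - ?g x)" by (intro continuous_intros cg)
  qed (use per pos in \<open>auto simp: exp_minus norm_inverse\<close>)
  then have "inverse (cmod (h 0)) \<le> inverse (exp (integral {0..2*pi} ?g / (2*pi)))"
    by (simp add: norm_inverse exp_minus)
  then have "exp (integral {0..2*pi} ?g / (2*pi)) \<le> cmod (h 0)"
    using pos[of 0] by (simp add: inverse_le_iff_le)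
  then have "integral {0..2*pi} ?g / (2*pi) \<le> ln (cmod (h 0))"
    using pos[of 0] by (simp add: ln_ge_iff)
  with 1 show ?thesis by simp
qed

text \<open>
  The logarithm of a modulus, with the value \<open>-\<infinity>\<close> at a zero; \<open>ln\<close> itself has a finite default
  value there.
\<close>

definition elog :: "real \<Rightarrow> ereal" where
  "elog x = (if x \<le> 0 then -\<infinity> else ereal (ln x))"

lemma elog_less_iff: "elog x < ereal M \<longleftrightarrow> x < exp M"
  using exp_gt_zero[of M] ln_less_cancel_iff[of x "exp M"]
  by (auto simp: elog_def simp del: exp_gt_zero intro: le_less_trans)

lemma elog_le_iff: "elog x \<le> ereal M \<longleftrightarrow> x \<le> exp M"
  using exp_gt_zero[of M] ln_le_cancel_iff[of x "exp M"]
  by (auto simp: elog_def simp del: exp_gt_zero intro: order_trans)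

lemma exp_ereal_elog: "0 \<le> x \<Longrightarrow> exp_ereal (elog x) = ereal x"
  by (auto simp: elog_def exp_ereal_def)

lemma exp_ereal_mono: "x \<le> y \<Longrightarrow> exp_ereal x \<le> exp_ereal y"
  by (cases x; cases y) (auto simp: exp_ereal_def)

lemma set_nn_integral_continuous_Icc:
  fixes g :: "real \<Rightarrow> real"
  assumes "continuous_on {a..b} g" "\<And>x. 0 \<le> g x"
  shows "(\<integral>\<^sup>+x\<in>{a..b}. ennreal (g x) \<partial>lborel) = ennreal (integral {a..b} g)"
proof -
  have "(g has_integral integral {a..b} g) {a..b}"
    using assms(1) by (intro integrable_integral integrable_continuous_real)
  then have "(\<integral>\<^sup>+x. ennreal (indicator {a..b} x * g x) \<partial>lborel) = ennreal (integral {a..b} g)"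
    using assms by (intro nn_integral_has_integral_lebesgue) auto
  moreover have "ennreal (indicator {a..b} x * g x) = ennreal (g x) * indicator {a..b} x" for x
    by (auto simp: indicator_def)
  ultimately show ?thesis by simp
qed

lemma e2ennreal_ereal: "e2ennreal (ereal x) = ennreal (max 0 x)"
    by (metis e2ennreal_neg enn2ereal_ennreal e2ennreal_enn2ereal ereal_less_eq(3) ennreal_neg linorder_linear max.absorb1 max.absorb2 zero_ereal_def)

lemma circle_mean_mono:
  assumes "\<And>w. cmod w = 1 \<Longrightarrow> F w \<le> G w"
  shows "circle_mean F \<le> circle_mean G"
proof -
  have "(\<integral>\<^sup>+\<theta>\<in>{0..2*pi}. e2ennreal (F (cis \<theta>)) \<partial>lborel) \<le> (\<integral>\<^sup>+\<theta>\<in>{0..2*pi}. e2ennreal (G (cis \<theta>)) \<partial>lborel)"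
    using assms by (intro nn_integral_mono mult_right_mono e2ennreal_mono) auto
  moreover have "(\<integral>\<^sup>+\<theta>\<in>{0..2*pi}. e2ennreal (- G (cis \<theta>)) \<partial>lborel) \<le> (\<integral>\<^sup>+\<theta>\<in>{0..2*pi}. e2ennreal (- F (cis \<theta>)) \<partial>lborel)"
    using assms by (intro nn_integral_mono mult_right_mono e2ennreal_mono) auto
  ultimately show ?thesis unfolding circle_mean_def
    by (intro ereal_divide_right_mono ereal_minus_mono) (auto simp: less_eq_ennreal.rep_eq[symmetric])
qed

lemma circle_mean_continuous:
  fixes g :: "complex \<Rightarrow> real"
  assumes g: "continuous_on {0..2*pi} (\<lambda>x. g (cis x))"
  shows "circle_mean (\<lambda>w. ereal (g w)) = ereal (integral {0..2*pi} (\<lambda>x. g (cis x)) / (2*pi))"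
proof -
  let ?P = "\<lambda>x. max 0 (g (cis x))" and ?N = "\<lambda>x. max 0 (- g (cis x))"
  have c: "continuous_on {0..2*pi} ?P" "continuous_on {0..2*pi} ?N"
    by (intro continuous_intros g)+
  have i: "?P integrable_on {0..2*pi}" "?N integrable_on {0..2*pi}"
    using c by (auto intro: integrable_continuous_real)
  have 1: "(\<integral>\<^sup>+\<theta>\<in>{0..2*pi}. e2ennreal (ereal (g (cis \<theta>))) \<partial>lborel) = ennreal (integral {0..2*pi} ?P)"
    unfolding e2ennreal_ereal by (intro set_nn_integral_continuous_Icc c) auto
  have 2: "(\<integral>\<^sup>+\<theta>\<in>{0..2*pi}. e2ennreal (- ereal (g (cis \<theta>))) \<partial>lborel) = ennreal (integral {0..2*pi} ?N)"
    unfolding uminus_ereal.simps e2ennreal_ereal by (intro set_nn_integral_continuous_Icc c) auto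
  have "integral {0..2*pi} (\<lambda>x. g (cis x)) = integral {0..2*pi} (\<lambda>x. ?P x - ?N x)"
    by (intro integral_cong) auto
  also have "\<dots> = integral {0..2*pi} ?P - integral {0..2*pi} ?N"
    by (intro Henstock_Kurzweil_Integration.integral_diff i)
  finally have 3: "integral {0..2*pi} ?P - integral {0..2*pi} ?N = integral {0..2*pi} (\<lambda>x. g (cis x))" by simp
  have "0 \<le> integral {0..2*pi} ?P" "0 \<le> integral {0..2*pi} ?N"
    by (intro Henstock_Kurzweil_Integration.integral_nonneg i; simp)+
  then show ?thesis
    unfolding circle_mean_def 1 2 by (simp add: enn2ereal_ennreal 3)
qed

text \<open>
  The truncations \<open>g n = max (ln (cmod (h w))) (- n)\<close> are continuous majorants, to which
  \<open>norm_center_le_exp_mean\<close> applies.  Their positive parts do not depend on \<open>n\<close>, and their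
  negative parts increase to the negative part of the logarithm, so that monotone convergence
  carries the bound to the limit, where the negative part has a finite integral.
\<close>

lemma elog_norm_le_circle_mean:
  fixes h :: "complex \<Rightarrow> complex"
  assumes h: "h holomorphic_on ball 0 1" "continuous_on (cball 0 1) h"
  shows "elog (cmod (h 0)) \<le> circle_mean (\<lambda>w. elog (cmod (h w)))"
proof (cases "h 0 = 0")
  case True
  then show ?thesis by (simp add: elog_def)
next
  case False
  define m where "m w = cmod (h w)" for w
  define g where "g n w = ln (max (m w) (exp (- real n)))" for n w
  have mc: "continuous_on UNIV (\<lambda>x. m (cis x))"
    unfolding m_def by (intro continuous_intros continuous_on_compose2[OF h(2)]) auto
  have mx: "max y (exp (- real n)) > 0" for y n by (simp add: less_max_iff_disj)
  have "continuous_on UNIV (\<lambda>x. g n (cis x))" for n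
    unfolding g_def using mx by (intro continuous_intros mc ballI) (metis less_irrefl)
  then have gc: "continuous_on S (\<lambda>x. g n (cis x))" for n S
    using continuous_on_subset by blast
  define L where "L = ln (cmod (h 0))"
  have 1: "2 * pi * L \<le> integral {0..2*pi} (\<lambda>x. g n (cis x))" for n
  proof -
    have "cmod (h 0) \<le> exp (integral {0..2*pi} (\<lambda>x. g n (cis x)) / (2*pi))"
    proof (rule norm_center_le_exp_mean[OF h gc])
      show "g n (cis (x + 2 * pi)) = g n (cis x)" for x by (simp add: cis.ctr)
      show "cmod (h (cis x)) \<le> exp (g n (cis x))" for x
        unfolding g_def m_def exp_ln[OF mx] by simp
    qed
    then have "L \<le> integral {0..2*pi} (\<lambda>x. g n (cis x)) / (2*pi)"
      using ln_le_cancel_iff[of "cmod (h 0)" "exp (integral {0..2*pi} (\<lambda>x. g n (cis x)) / (2*pi))"] False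
      by (simp add: L_def)
    then show ?thesis by (simp add: field_simps)
  qed
  define P where "P = integral {0..2*pi} (\<lambda>x. max 0 (g 0 (cis x)))"
  have m0: "0 \<le> m w" for w by (simp add: m_def)
  have g1: "g n w = max (ln (m w)) (- real n)" if "m w > 0" for n w
  proof (cases "m w \<le> exp (- real n)")
    case True
    then have "ln (m w) \<le> ln (exp (- real n))" using that by (subst ln_le_cancel_iff) auto
    with True show ?thesis by (simp add: g_def max_absorb2)
  next
    case False
    then have "ln (exp (- real n)) \<le> ln (m w)" using that by (subst ln_le_cancel_iff) auto
    with False show ?thesis by (simp add: g_def max_absorb1)
  qed
  have g2: "g n w = - real n" if "m w = 0" for n w
    by (simp add: g_def that max_absorb2)
  have pos: "max 0 (g n w) = max 0 (g 0 w)" for n w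
    using m0[of w] by (cases "m w = 0") (auto simp: g1 g2)
  define Nn where "Nn n = integral {0..2*pi} (\<lambda>x. max 0 (- g n (cis x)))" for n
  have ic: "(\<lambda>x. max 0 (g n (cis x))) integrable_on {0..2*pi}" "(\<lambda>x. max 0 (- g n (cis x))) integrable_on {0..2*pi}" for n
    by (intro integrable_continuous_real continuous_intros gc)+
  have Nn: "Nn n \<le> P - 2 * pi * L" for n
  proof -
    have "integral {0..2*pi} (\<lambda>x. g n (cis x)) = integral {0..2*pi} (\<lambda>x. max 0 (g n (cis x)) - max 0 (- g n (cis x)))"
      by (intro integral_cong) auto
    also have "\<dots> = P - Nn n"
      unfolding P_def Nn_def pos[of n, symmetric]
      by (intro Henstock_Kurzweil_Integration.integral_diff ic)
    finally show ?thesis using 1[of n] by simp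
  qed
  have Nn0: "0 \<le> Nn n" for n unfolding Nn_def
    by (intro Henstock_Kurzweil_Integration.integral_nonneg ic) auto
  have P0: "0 \<le> P" unfolding P_def
    by (intro Henstock_Kurzweil_Integration.integral_nonneg ic) auto
  have e1: "e2ennreal (elog (m w)) = ennreal (max 0 (g 0 w))" for w
  proof (cases "m w = 0")
    case True
    then show ?thesis by (simp add: elog_def g2 e2ennreal_neg)
  next
    case False
    then have "m w > 0" using m0[of w] by simp
    then show ?thesis by (auto simp: elog_def g1 max_def ennreal_neg)
  qed
  have e2: "e2ennreal (- elog (m w)) = (SUP n. ennreal (max 0 (- g n w)))" for w
  proof (cases "m w = 0")
    case True
    have S: "(SUP n. ennreal (real n)) = top"
      by (simp add: ennreal_of_nat_eq_real_of_nat[symmetric] ennreal_SUP_of_nat_eq_top)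
    have "(SUP n. ennreal (max 0 (- g n w))) = (SUP n. ennreal (real n))" by (simp add: g2[OF True])
    also have "\<dots> = e2ennreal (- elog (m w))" unfolding S by (simp add: elog_def True)
    finally show ?thesis by (rule sym)
  next
    case False
    then have m: "m w > 0" using m0[of w] by simp
    have "(SUP n. ennreal (max 0 (- g n w))) = ennreal (max 0 (- ln (m w)))"
    proof (rule antisym)
      show "(SUP n. ennreal (max 0 (- g n w))) \<le> ennreal (max 0 (- ln (m w)))"
        by (intro SUP_least ennreal_leI) (auto simp: g1[OF m])
      obtain n :: nat where "- ln (m w) \<le> n" using real_arch_simple by blast
      then have "g n w = ln (m w)" by (simp add: g1[OF m])
      then show "ennreal (max 0 (- ln (m w))) \<le> (SUP n. ennreal (max 0 (- g n w)))"
        by (metis SUP_upper UNIV_I)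
    qed
    then show ?thesis using m by (auto simp: elog_def max_def ennreal_neg)
  qed
  have I1: "(\<integral>\<^sup>+\<theta>\<in>{0..2*pi}. e2ennreal (elog (m (cis \<theta>))) \<partial>lborel) = ennreal P"
    unfolding e1 P_def by (intro set_nn_integral_continuous_Icc continuous_intros gc) auto
  have I2: "(\<integral>\<^sup>+\<theta>\<in>{0..2*pi}. e2ennreal (- elog (m (cis \<theta>))) \<partial>lborel) \<le> ennreal (P - 2 * pi * L)"
  proof -
    have "(\<integral>\<^sup>+\<theta>\<in>{0..2*pi}. e2ennreal (- elog (m (cis \<theta>))) \<partial>lborel)
        = (\<integral>\<^sup>+\<theta>. (SUP n. ennreal (max 0 (- g n (cis \<theta>))) * indicator {0..2*pi} \<theta>) \<partial>lborel)"
      unfolding e2 by (simp add: SUP_mult_right_ennreal)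
    also have "\<dots> = (SUP n. \<integral>\<^sup>+\<theta>\<in>{0..2*pi}. ennreal (max 0 (- g n (cis \<theta>))) \<partial>lborel)"
    proof (rule nn_integral_monotone_convergence_SUP)
      show "incseq (\<lambda>n \<theta>. ennreal (max 0 (- g n (cis \<theta>))) * indicator {0..2*pi} \<theta>)"
      proof (intro incseq_SucI le_funI mult_right_mono ennreal_leI)
        fix n \<theta>
        have "max (m (cis \<theta>)) (exp (- real (Suc n))) \<le> max (m (cis \<theta>)) (exp (- real n))"
          by (intro max.mono) auto
        then have "g (Suc n) (cis \<theta>) \<le> g n (cis \<theta>)"
          unfolding g_def using ln_le_cancel_iff[OF mx mx] by blast
        then show "max 0 (- g n (cis \<theta>)) \<le> max 0 (- g (Suc n) (cis \<theta>))" by auto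
      qed simp
      have "(\<lambda>\<theta>. g n (cis \<theta>)) \<in> borel_measurable borel" for n
        by (intro borel_measurable_continuous_onI gc)
      then show "(\<lambda>\<theta>. ennreal (max 0 (- g n (cis \<theta>))) * indicator {0..2*pi} \<theta>) \<in> borel_measurable lborel" for n
        by measurable
    qed
    also have "\<dots> \<le> ennreal (P - 2 * pi * L)"
    proof (rule SUP_least)
      fix n
      have "(\<integral>\<^sup>+\<theta>\<in>{0..2*pi}. ennreal (max 0 (- g n (cis \<theta>))) \<partial>lborel) = ennreal (Nn n)"
        unfolding Nn_def by (intro set_nn_integral_continuous_Icc continuous_intros gc) auto
      then show "(\<integral>\<^sup>+\<theta>\<in>{0..2*pi}. ennreal (max 0 (- g n (cis \<theta>))) \<partial>lborel) \<le> ennreal (P - 2 * pi * L)"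
        using Nn[of n] by (simp add: ennreal_leI)
    qed
    finally show ?thesis .
  qed
  have "P - 2 * pi * L \<ge> 0" using Nn[of 0] Nn0[of 0] by linarith
  then have "enn2ereal (\<integral>\<^sup>+\<theta>\<in>{0..2*pi}. e2ennreal (- elog (m (cis \<theta>))) \<partial>lborel) \<le> ereal (P - 2 * pi * L)"
    using I2 by (metis enn2ereal_ennreal less_eq_ennreal.rep_eq)
  then have "ereal P - ereal (P - 2 * pi * L)
     \<le> ereal P - enn2ereal (\<integral>\<^sup>+\<theta>\<in>{0..2*pi}. e2ennreal (- elog (m (cis \<theta>))) \<partial>lborel)"
    by (intro ereal_minus_mono) auto
  then have "ereal (2 * pi * L) / ereal (2 * pi) \<le> circle_mean (\<lambda>w. elog (m w))"
    unfolding circle_mean_def I1 enn2ereal_ennreal[OF P0]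
    by (intro ereal_divide_right_mono) auto
  then show ?thesis using False by (simp add: elog_def L_def m_def)
qed

section \<open>Plurisubharmonic functions along curved disks\<close>

lemma usc_attains_max:
  fixes W :: "'a::topological_space \<Rightarrow> ereal"
  assumes C: "compact C" "C \<noteq> {}"
    and usc: "\<And>x M. x \<in> C \<Longrightarrow> W x < M \<Longrightarrow> \<forall>\<^sub>F y in at x within C. W y < M"
  obtains x where "x \<in> C" "\<And>y. y \<in> C \<Longrightarrow> W y \<le> W x"
proof (rule ccontr)
  assume "\<not> thesis"
  then have "\<forall>x\<in>C. \<exists>y\<in>C. W x < W y" using that by (meson not_le)
  then obtain g where g: "\<And>x. x \<in> C \<Longrightarrow> g x \<in> C" "\<And>x. x \<in> C \<Longrightarrow> W x < W (g x)" by metis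
  have "\<exists>T. open T \<and> x \<in> T \<and> (\<forall>y\<in>T \<inter> C. W y < W (g x))" if "x \<in> C" for x
    using usc[OF that g(2)[OF that]] g(2)[OF that] unfolding eventually_at_topological by auto
  then obtain T where T: "\<And>x. x \<in> C \<Longrightarrow> open (T x)" "\<And>x. x \<in> C \<Longrightarrow> x \<in> T x"
    "\<And>x y. x \<in> C \<Longrightarrow> y \<in> T x \<Longrightarrow> y \<in> C \<Longrightarrow> W y < W (g x)" by (metis IntI)
  have "C \<subseteq> (\<Union>x\<in>C. T x)" using T(2) by blast
  then obtain F where F: "F \<subseteq> C" "finite F" "C \<subseteq> (\<Union>x\<in>F. T x)"
    using compactE_image[OF C(1), of C T] T(1) by metis
  then have "F \<noteq> {}" using C(2) by auto
  then have "Max ((\<lambda>x. W (g x)) ` F) \<in> (\<lambda>x. W (g x)) ` F" using F(2) by (intro Max_in) auto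
  then obtain m where m: "m \<in> F" "W (g m) = Max ((\<lambda>x. W (g x)) ` F)" by auto
  have "g m \<in> C" using m F g by auto
  then obtain x where x: "x \<in> F" "g m \<in> T x" using F(3) by auto
  have "W (g m) < W (g x)" using T(3)[of x "g m"] x F(1) \<open>g m \<in> C\<close> by auto
  moreover have "W (g x) \<le> W (g m)" unfolding m(2) using F(2) x by (intro Max_ge) auto
  ultimately show False by simp
qed

lemma usc_add_continuous:
  fixes f :: "'a \<Rightarrow> ereal" and \<psi> :: "'a \<Rightarrow> real"
  assumes f: "\<And>M. a < M \<Longrightarrow> \<forall>\<^sub>F y in F. f y < M" and \<psi>: "(\<psi> \<longlongrightarrow> p) F"
    and M: "a + ereal p < M"
  shows "\<forall>\<^sub>F y in F. f y + ereal (\<psi> y) < M"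
proof -
  have "a < M - ereal p" using M by (cases a; cases M) auto
  then obtain c where c: "a < ereal c" "ereal c < M - ereal p" using ereal_dense2 by blast
  have "((\<lambda>y. ereal (c + \<psi> y)) \<longlongrightarrow> ereal (c + p)) F" by (intro tendsto_intros \<psi>)
  moreover have "ereal (c + p) < M" using c(2) by (cases M) auto
  ultimately have "\<forall>\<^sub>F y in F. ereal (c + \<psi> y) < M" by (rule order_tendstoD)
  with f[OF c(1)] show ?thesis
  proof eventually_elim
    case (elim y)
    have "f y + ereal (\<psi> y) \<le> ereal c + ereal (\<psi> y)"
      using elim by (intro add_right_mono) auto
    then show ?case using elim by simp
  qed
qed

lemma psh_usc_nhds:
  assumes f: "plurisubharmonic_on f U" and U: "open U" and x: "x \<in> U" and M: "f x < M"
  shows "\<forall>\<^sub>F y in nhds x. y \<in> U \<and> f y < M"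
proof -
  have "\<forall>x\<in>U. \<forall>M. f x < M \<longrightarrow> (\<forall>\<^sub>F y in at x within U. f y < M)"
    by (rule conjunct1[OF conjunct2[OF f[unfolded plurisubharmonic_on_def]]])
  then have "\<forall>\<^sub>F y in at x within U. f y < M"
    using x M by simp
  then have "\<forall>\<^sub>F y in at x. f y < M" by (simp only: at_within_open[OF x U])
  then have "\<forall>\<^sub>F y in nhds x. f y < M" using M by (simp only: eventually_nhds_conv_at)
  with eventually_nhds_in_open[OF U x] show ?thesis by (rule eventually_conj)
qed

lemma in_interior_of_eventually: "\<forall>\<^sub>F y in nhds x. y \<in> S \<Longrightarrow> x \<in> interior S"
  unfolding eventually_nhds interior_def by blast

lemma isCont_tendsto_nhds: "isCont g a \<Longrightarrow> g a = b \<Longrightarrow> (g \<longlongrightarrow> b) (nhds a)"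
  by (auto simp: isCont_def tendsto_at_iff_tendsto_nhds)

lemma cmod_add_power2: "(cmod (a + b))\<^sup>2 = (cmod a)\<^sup>2 + 2 * Re (cnj a * b) + (cmod b)\<^sup>2"
  unfolding cmod_power2 by (simp add: power2_eq_square algebra_simps)

lemma norm_Pair_power2: "(norm (a, b))\<^sup>2 = (norm a)\<^sup>2 + (norm b)\<^sup>2"
  by (simp add: norm_Pair)

lemma derivative_remainder_bound:
  fixes d :: "complex \<Rightarrow> complex"
  assumes "d holomorphic_on \<Omega>" "open \<Omega>" "a \<in> \<Omega>" "0 < e"
  shows "\<forall>\<^sub>F \<rho> in at_right 0. \<forall>w. cmod w \<le> 1 \<longrightarrow>
    cmod (d (a + of_real \<rho> * w) - d a - deriv d a * (of_real \<rho> * w)) \<le> e * \<rho>"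
proof -
  have "(d has_derivative (*) (deriv d a)) (at a)"
    using holomorphic_derivI[OF assms(1,2,3)] by (simp add: has_field_derivative_def)
  then have "\<exists>\<delta>>0. \<forall>y. norm (y - a) < \<delta> \<longrightarrow> norm (d y - d a - deriv d a * (y - a)) \<le> e * norm (y - a)"
    using assms(4) unfolding has_derivative_at_alt by simp
  then obtain \<delta> where \<delta>: "\<delta> > 0" and
    D: "\<And>y. norm (y - a) < \<delta> \<Longrightarrow> norm (d y - d a - deriv d a * (y - a)) \<le> e * norm (y - a)"
    by auto
  then have *: "cmod (d (a + h) - d a - deriv d a * h) \<le> e * cmod h" if "cmod h < \<delta>" for h
    using D[of "a + h"] that by simp
  have "\<forall>\<^sub>F \<rho>::real in at_right 0. \<rho> < \<delta>" "\<forall>\<^sub>F \<rho>::real in at_right 0. 0 < \<rho>"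
    using \<delta> by (auto simp: eventually_at_right_less intro: order_tendstoD(2)[OF tendsto_ident_at])
  then show ?thesis
  proof eventually_elim
    case (elim \<rho>)
    show ?case
    proof (intro allI impI)
      fix w :: complex assume "cmod w \<le> 1"
      then have h: "cmod (of_real \<rho> * w) \<le> \<rho>" using elim by (simp add: norm_mult mult_left_le)
      then have "cmod (d (a + of_real \<rho> * w) - d a - deriv d a * (of_real \<rho> * w)) \<le> e * cmod (of_real \<rho> * w)"
        using elim by (intro *) auto
      also have "\<dots> \<le> e * \<rho>" using h assms(4) by (intro mult_left_mono) auto
      finally show "cmod (d (a + of_real \<rho> * w) - d a - deriv d a * (of_real \<rho> * w)) \<le> e * \<rho>" .
    qed
  qed
qed

text \<open>
  Write \<open>D l = (d1 l, d2 l)\<close> and \<open>h l = \<kappa> * ln (cmod (B l))\<close>, a harmonic function, and suppose that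
  the inequality fails at \<open>l0\<close>.  Maximize
  \<open>f (D l + x) - h l + \<epsilon> * (cmod l)\<^sup>2 - K * (norm x)\<^sup>2\<close> over \<open>l\<close> in \<open>L\<close> and small translations \<open>x\<close>.
  The boundary condition keeps the maximum away from the frontier of \<open>L\<close>, and a large \<open>K\<close> keeps it
  away from the boundary of the ball of translations.  At an interior maximum \<open>(l1, x1)\<close>, the
  affine disk through \<open>D l1 + x1\<close> in the direction of the derivative of \<open>D\<close> has the form
  \<open>D (l1 + \<rho> * w) + (x1 - E w)\<close>, where \<open>E w\<close> is the remainder of the first-order expansion.
  The cross term in \<open>(norm (x1 - E w))\<^sup>2\<close> is the real part of a holomorphic function that
  vanishes at \<open>0\<close> and has mean zero, and \<open>(norm (E w))\<^sup>2\<close> is a small multiple of \<open>\<rho>\<^sup>2\<close>.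
  The term \<open>\<epsilon> * (cmod l)\<^sup>2\<close> gains \<open>\<epsilon> * \<rho>\<^sup>2\<close> on average and wins, against the sub-mean value
  inequality for \<open>f\<close> on that affine disk.
\<close>

theorem psh_maximum_principle_along_disk:
  fixes f :: "complex \<times> complex \<Rightarrow> ereal" and d1 d2 B :: "complex \<Rightarrow> complex" and \<kappa> :: real
  assumes psh: "plurisubharmonic_on f U" and U: "open U" and neg: "\<And>y. y \<in> U \<Longrightarrow> f y \<le> 0"
    and \<Omega>: "open \<Omega>" "L \<subseteq> \<Omega>" "compact L"
    and d: "d1 holomorphic_on \<Omega>" "d2 holomorphic_on \<Omega>" "\<And>l. l \<in> \<Omega> \<Longrightarrow> (d1 l, d2 l) \<in> U"
    and B: "B holomorphic_on \<Omega>" "\<And>l. l \<in> \<Omega> \<Longrightarrow> B l \<noteq> 0"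
    and bd: "\<And>l. l \<in> frontier L \<Longrightarrow> f (d1 l, d2 l) \<le> ereal (\<kappa> * ln (cmod (B l)))"
    and l0: "l0 \<in> L"
  shows "f (d1 l0, d2 l0) \<le> ereal (\<kappa> * ln (cmod (B l0)))"
proof (rule ccontr)
  define h where "h l = \<kappa> * ln (cmod (B l))" for l
  define D where "D l = (d1 l, d2 l)" for l
  assume "\<not> ?thesis"
  then have gt: "ereal (h l0) < f (D l0)" by (simp add: h_def D_def)
  have DU: "D l \<in> U" if "l \<in> \<Omega>" for l using d(3)[OF that] by (simp add: D_def)
  then have "f (D l0) \<le> 0" using neg[OF DU[of l0]] l0 \<Omega> by blast
  with gt obtain F0 where F0: "f (D l0) = ereal F0" by (cases "f (D l0)") auto
  define s where "s = F0 - h l0"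
  have s: "s > 0" using gt F0 by (simp add: s_def)
  have hc: "continuous_on \<Omega> h" unfolding h_def
    using B by (intro continuous_intros holomorphic_on_imp_continuous_on[OF B(1)]) auto
  have Dc: "continuous_on \<Omega> D" unfolding D_def
    by (intro continuous_intros holomorphic_on_imp_continuous_on d)
  have Lc: "closed L" using \<Omega> compact_imp_closed by blast
  have frL: "frontier L \<subseteq> L" using Lc by (simp add: frontier_subset_closed)
  obtain R where R: "R > 0" "\<And>l. l \<in> L \<Longrightarrow> cmod l \<le> R"
    using compact_imp_bounded[OF \<Omega>(3)] bounded_pos by blast
  \<comment> \<open>Small enough for the term \<open>\<epsilon> * (cmod l)\<^sup>2\<close> to cost at most a quarter of the excess \<open>s\<close>.\<close>
  define \<epsilon> where "\<epsilon> = s / (4 * R\<^sup>2)"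
  have \<epsilon>: "\<epsilon> > 0" using s R by (simp add: \<epsilon>_def)
  have \<epsilon>s: "\<epsilon> * (cmod l)\<^sup>2 \<le> s / 4" if "l \<in> L" for l
  proof -
    have "\<epsilon> * (cmod l)\<^sup>2 \<le> \<epsilon> * R\<^sup>2" using R(2)[OF that] \<epsilon> by (intro mult_left_mono power_mono) auto
    then show ?thesis using R(1) by (simp add: \<epsilon>_def)
  qed
  obtain Hb where Hb: "\<And>l. l \<in> L \<Longrightarrow> \<bar>h l\<bar> \<le> Hb"
  proof -
    have "compact (h ` L)" using hc \<Omega> continuous_on_subset compact_continuous_image by blast
    then have "bounded (h ` L)" by (rule compact_imp_bounded)
    then show ?thesis using that unfolding bounded_iff by auto
  qed
  have nh: "\<forall>\<^sub>F x in nhds (0, l). D (snd x) + fst x \<in> U \<and> f (D (snd x) + fst x) < M"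
    if "l \<in> \<Omega>" "f (D l) < M" for l M
  proof -
    have "isCont D l" using Dc \<Omega>(1) that(1) by (simp add: continuous_on_eq_continuous_at)
    then have "isCont (\<lambda>x. D (snd x) + fst x) (0, l)"
      by (intro continuous_intros isCont_o2[where g = D and f = snd]) auto
    then have "filterlim (\<lambda>x. D (snd x) + fst x) (nhds (D l)) (nhds (0, l))"
      by (rule isCont_tendsto_nhds) simp
    with psh_usc_nhds[OF psh U DU[OF that(1)] that(2)] show ?thesis
      by (rule eventually_compose_filterlim)
  qed
  \<comment> \<open>Openness of \<open>U\<close>, and below the upper semicontinuity of \<open>f\<close>, give a radius for the translations
    at each parameter; compactness makes it uniform.\<close>
  obtain r1 where r1: "r1 > 0" "\<And>l x. l \<in> L \<Longrightarrow> norm x \<le> r1 \<Longrightarrow> D l + x \<in> U"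
  proof -
    define V where "V = interior {x. D (snd x) + fst x \<in> U}"
    have "(0, l) \<in> V" if "l \<in> L" for l
    proof -
      have l: "l \<in> \<Omega>" using that \<Omega> by auto
      have "f (D l) < \<infinity>" using neg[OF DU[OF l]] by (rule le_less_trans) simp
      from nh[OF l this] have "\<forall>\<^sub>F x in nhds (0, l). D (snd x) + fst x \<in> U"
        by (rule eventually_mono) simp
      then show ?thesis unfolding V_def by (intro in_interior_of_eventually) simp
    qed
    then have sub: "{0} \<times> L \<subseteq> V" by auto
    have "open V" by (simp add: V_def)
    then obtain X where X: "0 \<in> X" "open X" "X \<times> L \<subseteq> V"
      using Elementary_Topology.tube_lemma[OF \<Omega>(3) _ sub] by blast
    then obtain e where e: "e > 0" "cball 0 e \<subseteq> X" using open_contains_cball by blast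
    have "D l + x \<in> U" if "l \<in> L" "norm x \<le> e" for l x
    proof -
      have "(x, l) \<in> V" using that e X by auto
      then show ?thesis using interior_subset unfolding V_def by force
    qed
    then show ?thesis using that e by blast
  qed
  obtain r2 where r2: "r2 > 0"
    "\<And>l x. l \<in> frontier L \<Longrightarrow> norm x \<le> r2 \<Longrightarrow> f (D l + x) < ereal (h l + s / 4)"
  proof -
    define V where "V = interior {x. f (D (snd x) + fst x) < ereal (h (snd x) + s / 4)}"
    have "(0, l) \<in> V" if l: "l \<in> frontier L" for l
    proof -
      have l\<Omega>: "l \<in> \<Omega>" using l frL \<Omega> by auto
      have "f (D l) \<le> ereal (h l)" using bd[OF l] by (simp add: h_def D_def)
      also have "\<dots> < ereal (h l + s / 8)" using s by simp
      finally have "f (D l) < ereal (h l + s / 8)" .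
      from nh[OF l\<Omega> this] have 1: "\<forall>\<^sub>F x in nhds (0, l). f (D (snd x) + fst x) < ereal (h l + s / 8)"
        by (rule eventually_mono) simp
      have "isCont h l" using hc \<Omega>(1) l\<Omega> by (simp add: continuous_on_eq_continuous_at)
      then have "isCont (\<lambda>x. h (snd x)) (0::complex \<times> complex, l)"
        by (intro isCont_o2[where g = h and f = snd]) auto
      then have "((\<lambda>x. h (snd x)) \<longlongrightarrow> h l) (nhds (0::complex \<times> complex, l))"
        by (rule isCont_tendsto_nhds) simp
      then have "\<forall>\<^sub>F x in nhds (0::complex \<times> complex, l). h l - s / 8 < h (snd x)"
        using s by (intro order_tendstoD) auto
      with 1 have "\<forall>\<^sub>F x in nhds (0, l). f (D (snd x) + fst x) < ereal (h (snd x) + s / 4)"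
      proof eventually_elim
        case (elim x)
        have "ereal (h l + s / 8) \<le> ereal (h (snd x) + s / 4)" using elim by simp
        then show ?case using elim(1) by (rule less_le_trans[rotated])
      qed
      then show ?thesis unfolding V_def by (intro in_interior_of_eventually) simp
    qed
    then have sub: "{0} \<times> frontier L \<subseteq> V" by auto
    have "open V" "compact (frontier L)" using \<Omega>(3) by (auto simp: V_def compact_frontier)
    then obtain X where X: "0 \<in> X" "open X" "X \<times> frontier L \<subseteq> V"
      using Elementary_Topology.tube_lemma[OF _ _ sub] by blast
    then obtain e where e: "e > 0" "cball 0 e \<subseteq> X" using open_contains_cball by blast
    have "f (D l + x) < ereal (h l + s / 4)" if "l \<in> frontier L" "norm x \<le> e" for l x
    proof -
      have "(x, l) \<in> V" using that e X by auto
      then show ?thesis using interior_subset unfolding V_def by force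
    qed
    then show ?thesis using that e by blast
  qed
  define r where "r = min r1 r2"
  have r: "r > 0" "r \<le> r1" "r \<le> r2" using r1 r2 by (auto simp: r_def)
  \<comment> \<open>With this penalty a translation of norm \<open>r\<close> is worse than \<open>(l0, 0)\<close>, as \<open>f \<le> 0\<close> and \<open>\<bar>h l\<bar> \<le> Hb\<close>.\<close>
  define K where "K = (\<bar>Hb\<bar> + 1) / r\<^sup>2"
  have K: "K > 0" "K * r\<^sup>2 = \<bar>Hb\<bar> + 1" using r by (auto simp: K_def)
  define \<psi> where "\<psi> y = \<epsilon> * (cmod (fst y))\<^sup>2 - h (fst y) - K * (norm (snd y))\<^sup>2" for y :: "complex \<times> (complex \<times> complex)"
  define W where "W y = f (D (fst y) + snd y) + ereal (\<psi> y)" for y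
  define C where "C = L \<times> cball (0 :: complex \<times> complex) r"
  have "compact C" unfolding C_def using \<Omega>(3) by (intro compact_Times) auto
  moreover have "C \<noteq> {}" using l0 r by (auto simp: C_def)
  moreover have "\<forall>\<^sub>F y in at x within C. W y < M" if x: "x \<in> C" and M: "W x < M" for x M
    unfolding W_def
  proof (rule usc_add_continuous[where a = "f (D (fst x) + snd x)" and p = "\<psi> x"])
    have x1: "fst x \<in> L" "norm (snd x) \<le> r" using x by (auto simp: C_def)
    then have x2: "fst x \<in> \<Omega>" "D (fst x) + snd x \<in> U" using r1 r \<Omega> by auto
    have "isCont D (fst x)" "isCont h (fst x)"
      using Dc hc \<Omega>(1) x2 by (simp_all add: continuous_on_eq_continuous_at)
    note tD = isCont_tendsto_compose[OF this(1) tendsto_fst[OF tendsto_ident_at, of x C]]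
      and th = isCont_tendsto_compose[OF this(2) tendsto_fst[OF tendsto_ident_at, of x C]]
    show "(\<psi> \<longlongrightarrow> \<psi> x) (at x within C)"
      unfolding \<psi>_def by (intro tendsto_intros th)
    show "f (D (fst x) + snd x) + ereal (\<psi> x) < M" using M by (simp add: W_def)
    fix M assume "f (D (fst x) + snd x) < M"
    from psh_usc_nhds[OF psh U x2(2) this] have "\<forall>\<^sub>F y in nhds (D (fst x) + snd x). f y < M"
      by (rule eventually_mono) simp
    moreover have "filterlim (\<lambda>y. D (fst y) + snd y) (nhds (D (fst x) + snd x)) (at x within C)"
      by (intro tendsto_intros tD)
    ultimately show "\<forall>\<^sub>F y in at x within C. f (D (fst y) + snd y) < M"
      by (rule eventually_compose_filterlim)
  qed
  ultimately obtain m where m: "m \<in> C" "\<And>y. y \<in> C \<Longrightarrow> W y \<le> W m"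
    using usc_attains_max[of C W] by blast
  obtain l1 x1 where m12: "m = (l1, x1)" by (cases m)
  have l1: "l1 \<in> L" "norm x1 \<le> r" using m(1) by (auto simp: C_def m12)
  have "ereal s \<le> ereal F0 + ereal (\<epsilon> * (cmod l0)\<^sup>2 - h l0)"
    using \<epsilon> by (simp add: s_def)
  also have "\<dots> = W (l0, 0)" by (simp add: W_def \<psi>_def F0)
  also have "\<dots> \<le> W m" using l0 r by (intro m(2)) (auto simp: C_def)
  finally have Wm: "ereal s \<le> W m" .
  have f1: "f (D l1 + x1) \<le> 0" using neg r1 r l1 by auto
  have Wm': "W m = f (D l1 + x1) + ereal (\<psi> (l1, x1))" by (simp add: W_def m12)
  obtain F1 where F1: "f (D l1 + x1) = ereal F1"
    using f1 Wm unfolding Wm' by (cases "f (D l1 + x1)") auto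
  have sF: "s \<le> F1 + \<epsilon> * (cmod l1)\<^sup>2 - h l1 - K * (norm x1)\<^sup>2" "F1 \<le> 0"
    using Wm f1 unfolding Wm' F1 by (auto simp: \<psi>_def)
  have "l1 \<notin> frontier L"
  proof
    assume "l1 \<in> frontier L"
    then have "F1 < h l1 + s / 4" using r2(2)[of l1 x1] l1 r F1 by auto
    moreover have "0 \<le> K * (norm x1)\<^sup>2" using K by simp
    ultimately show False using sF \<epsilon>s[OF l1(1)] s by linarith
  qed
  then have l1i: "l1 \<in> interior L" using l1 Lc by (simp add: frontier_def)
  have x1r: "norm x1 < r"
  proof (rule ccontr)
    assume "\<not> ?thesis"
    then have "norm x1 = r" using l1 by simp
    then show False using sF \<epsilon>s[OF l1(1)] s K Hb[OF l1(1)] by simp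
  qed
  have l1\<Omega>: "l1 \<in> \<Omega>" using l1 \<Omega> by auto
  \<comment> \<open>First-order remainders of relative size \<open>e\<close> cost half of the gain \<open>\<epsilon> * \<rho>\<^sup>2\<close>.\<close>
  define e where "e = sqrt (\<epsilon> / (4 * K))"
  have e: "e > 0" "K * (2 * e\<^sup>2) = \<epsilon> / 2" using \<epsilon> K by (auto simp: e_def)
  define E1 where "E1 \<rho> w = d1 (l1 + of_real \<rho> * w) - d1 l1 - deriv d1 l1 * (of_real \<rho> * w)" for \<rho> :: real and w
  define E2 where "E2 \<rho> w = d2 (l1 + of_real \<rho> * w) - d2 l1 - deriv d2 l1 * (of_real \<rho> * w)" for \<rho> :: real and w
  have ev1: "\<forall>\<^sub>F \<rho> in at_right 0. \<forall>w. cmod w \<le> 1 \<longrightarrow> cmod (E1 \<rho> w) \<le> e * \<rho>"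
    unfolding E1_def using derivative_remainder_bound[OF d(1) \<Omega>(1) l1\<Omega> e(1)] .
  have ev2: "\<forall>\<^sub>F \<rho> in at_right 0. \<forall>w. cmod w \<le> 1 \<longrightarrow> cmod (E2 \<rho> w) \<le> e * \<rho>"
    unfolding E2_def using derivative_remainder_bound[OF d(2) \<Omega>(1) l1\<Omega> e(1)] .
  obtain \<delta> where \<delta>: "\<delta> > 0" "ball l1 \<delta> \<subseteq> L"
    using l1i by (meson mem_interior)
  have small: "\<forall>\<^sub>F \<rho>::real in at_right 0. \<rho> < c" if "c > 0" for c
    using that by (auto intro: order_tendstoD(2)[OF tendsto_ident_at])
  have "\<forall>\<^sub>F \<rho>::real in at_right 0. 0 < \<rho>" by (simp add: eventually_at_right_less)
  moreover have "\<forall>\<^sub>F \<rho>::real in at_right 0. \<rho> < (r - norm x1) / (2 * e)"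
    using x1r e by (intro small) auto
  ultimately have "\<forall>\<^sub>F \<rho> in at_right 0. 0 < \<rho> \<and> \<rho> < (r - norm x1) / (2 * e) \<and> \<rho> < \<delta> \<and>
      (\<forall>w. cmod w \<le> 1 \<longrightarrow> cmod (E1 \<rho> w) \<le> e * \<rho>) \<and> (\<forall>w. cmod w \<le> 1 \<longrightarrow> cmod (E2 \<rho> w) \<le> e * \<rho>)"
    using small[OF \<delta>(1)] ev1 ev2 by eventually_elim simp
  then obtain \<rho> where \<rho>: "0 < \<rho>" "\<rho> < (r - norm x1) / (2 * e)" "\<rho> < \<delta>"
      "\<And>w. cmod w \<le> 1 \<Longrightarrow> cmod (E1 \<rho> w) \<le> e * \<rho>" "\<And>w. cmod w \<le> 1 \<Longrightarrow> cmod (E2 \<rho> w) \<le> e * \<rho>"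
    using eventually_happens'[OF trivial_limit_at_right_real] by blast
  have inL: "l1 + of_real \<rho> * w \<in> L" if "cmod w \<le> 1" for w
  proof -
    have "\<rho> * cmod w \<le> \<rho> * 1" using \<rho>(1) that by (intro mult_left_mono) auto
    then have "\<rho> * cmod w < \<delta>" using \<rho>(3) by linarith
    then have "cmod (of_real \<rho> * w) < \<delta>" using \<rho>(1) by (simp add: norm_mult)
    then show ?thesis using \<delta> by (auto simp: dist_norm)
  qed
  \<comment> \<open>The affine line through the maximum point, tangent to the disk at \<open>l1\<close>.\<close>
  define E where "E w = (E1 \<rho> w, E2 \<rho> w)" for w
  define A where "A w = (fst (D l1 + x1) + w * (of_real \<rho> * deriv d1 l1), snd (D l1 + x1) + w * (of_real \<rho> * deriv d2 l1))" for w
  have AE: "A w = D (l1 + of_real \<rho> * w) + (x1 - E w)" for w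
    by (cases x1) (simp add: A_def D_def E_def E1_def E2_def algebra_simps)
  have nE: "(norm (E w))\<^sup>2 \<le> 2 * e\<^sup>2 * \<rho>\<^sup>2" "norm (x1 - E w) \<le> r" if w: "cmod w \<le> 1" for w
  proof -
    have "norm (E w) \<le> norm (E1 \<rho> w) + norm (E2 \<rho> w)"
      unfolding E_def by (rule norm_Pair_le)
    also have "\<dots> \<le> e * \<rho> + e * \<rho>" using \<rho>(4,5)[OF w] by (rule add_mono)
    also have "\<dots> < r - norm x1" using \<rho>(2) e by (simp add: field_simps)
    finally show "norm (x1 - E w) \<le> r" using norm_triangle_ineq4[of x1 "E w"] by linarith
    have "(norm (E w))\<^sup>2 = (cmod (E1 \<rho> w))\<^sup>2 + (cmod (E2 \<rho> w))\<^sup>2"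
      by (simp add: E_def norm_Pair)
    also have "\<dots> \<le> (e * \<rho>)\<^sup>2 + (e * \<rho>)\<^sup>2"
      using \<rho>(4,5)[OF w] by (intro add_mono power_mono) auto
    finally show "(norm (E w))\<^sup>2 \<le> 2 * e\<^sup>2 * \<rho>\<^sup>2" by (simp add: power_mult_distrib mult_ac)
  qed
  have inC: "(l1 + of_real \<rho> * w, x1 - E w) \<in> C" if "cmod w \<le> 1" for w
    using inL[OF that] nE(2)[OF that] by (simp add: C_def)
  have AU: "A w \<in> U" if "cmod w \<le> 1" for w
    unfolding AE using inL[OF that] nE(2)[OF that] r by (intro r1(2)) auto
  \<comment> \<open>The terms linear in \<open>w\<close> and \<open>E w\<close>, as the real part of a holomorphic function: their mean is zero.\<close>
  define g where "g w = 2 * \<epsilon> * cnj l1 * (of_real \<rho> * w) + 2 * K * (cnj (fst x1) * E1 \<rho> w + cnj (snd x1) * E2 \<rho> w)" for w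
  define u where "u w = (F1 - \<epsilon> * \<rho>\<^sup>2 / 2 - h l1) + h (l1 + of_real \<rho> * w) - Re (g w)" for w
  have fu: "f (A w) \<le> ereal (u w)" if w: "cmod w = 1" for w
  proof -
    have w': "cmod w \<le> 1" using w by simp
    have "f (A w) + ereal (\<psi> (l1 + of_real \<rho> * w, x1 - E w)) \<le> ereal (F1 + \<psi> (l1, x1))"
    proof -
      have "W (l1 + of_real \<rho> * w, x1 - E w) \<le> ereal F1 + ereal (\<psi> (l1, x1))"
        using m(2)[OF inC[OF w']] unfolding Wm' F1 .
      then show ?thesis unfolding W_def AE by simp
    qed
    then have "f (A w) \<le> ereal (F1 + \<psi> (l1, x1) - \<psi> (l1 + of_real \<rho> * w, x1 - E w))"
      by (cases "f (A w)") auto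
    also have "\<dots> \<le> ereal (u w)"
    proof -
      have 1: "(cmod (l1 + of_real \<rho> * w))\<^sup>2 = (cmod l1)\<^sup>2 + 2 * Re (cnj l1 * (of_real \<rho> * w)) + \<rho>\<^sup>2"
        unfolding cmod_add_power2 using w by (simp add: norm_mult)
      have 2: "(norm (x1 - E w))\<^sup>2 = (norm x1)\<^sup>2 - 2 * Re (cnj (fst x1) * E1 \<rho> w + cnj (snd x1) * E2 \<rho> w) + (norm (E w))\<^sup>2"
      proof -
        obtain a b where x1: "x1 = (a, b)" by (cases x1)
        show ?thesis
          unfolding x1 E_def diff_Pair norm_Pair_power2 fst_conv snd_conv
          using cmod_add_power2[of a "- E1 \<rho> w"] cmod_add_power2[of b "- E2 \<rho> w"] by simp
      qed
      have "K * (norm (E w))\<^sup>2 \<le> K * (2 * e\<^sup>2 * \<rho>\<^sup>2)" using K nE(1)[OF w'] by (intro mult_left_mono) auto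
      also have "\<dots> = \<epsilon> * \<rho>\<^sup>2 / 2" using e(2) by (simp add: algebra_simps)
      finally have 3: "K * (norm (E w))\<^sup>2 \<le> \<epsilon> * \<rho>\<^sup>2 / 2" .
      have 4: "Re (g w) = 2 * \<epsilon> * Re (cnj l1 * (of_real \<rho> * w)) + 2 * K * Re (cnj (fst x1) * E1 \<rho> w + cnj (snd x1) * E2 \<rho> w)"
        unfolding g_def by (simp add: algebra_simps)
      show ?thesis unfolding \<psi>_def u_def fst_conv snd_conv 1 2 4 using 3 by (simp add: algebra_simps)
    qed
    finally show ?thesis .
  qed
  have hol: "(\<lambda>w. d (l1 + of_real \<rho> * w)) holomorphic_on cball 0 1" if "d holomorphic_on \<Omega>" for d
    using inL \<Omega>(2) by (intro holomorphic_on_compose_gen[OF _ that, unfolded comp_def] holomorphic_intros) auto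
  have gh: "g holomorphic_on cball 0 1"
    unfolding g_def E1_def E2_def by (intro holomorphic_intros hol d)
  have bh: "(\<lambda>w. B (l1 + of_real \<rho> * w)) holomorphic_on cball 0 1" by (intro hol B)
  have g0: "g 0 = 0" by (simp add: g_def E1_def E2_def)
  have mg: "integral {0..2*pi} (\<lambda>x. Re (g (cis x))) = 0"
    using mean_ln_norm_eq[of "\<lambda>w. exp (g w)"] holomorphic_on_imp_continuous_on[OF gh] g0
      holomorphic_on_subset[OF gh ball_subset_cball]
    by (auto intro!: holomorphic_intros continuous_intros)
  have mb: "integral {0..2*pi} (\<lambda>x. h (l1 + of_real \<rho> * cis x)) = 2 * pi * h l1"
    using mean_ln_norm_eq[of "\<lambda>w. B (l1 + of_real \<rho> * w)"] holomorphic_on_imp_continuous_on[OF bh]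
      holomorphic_on_subset[OF bh ball_subset_cball] B(2) inL \<Omega>(2)
    by (simp add: h_def subset_eq field_simps)
  have circ: "continuous_on {0..2*pi} (\<lambda>x. Re (g (cis x)))"
    by (intro continuous_intros continuous_on_compose2[OF holomorphic_on_imp_continuous_on[OF gh]]) auto
  have cirh: "continuous_on {0..2*pi} (\<lambda>x. h (l1 + of_real \<rho> * cis x))"
    using inL \<Omega>(2) by (intro continuous_intros continuous_on_compose2[OF hc]) auto
  have "integral {0..2*pi} (\<lambda>x. u (cis x)) = 2 * pi * (F1 - \<epsilon> * \<rho>\<^sup>2 / 2)"
  proof -
    have i1: "((\<lambda>x::real. F1 - \<epsilon> * \<rho>\<^sup>2 / 2 - h l1) has_integral 2 * pi * (F1 - \<epsilon> * \<rho>\<^sup>2 / 2 - h l1)) {0..2*pi}"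
      using has_integral_const_real[of "F1 - \<epsilon> * \<rho>\<^sup>2 / 2 - h l1" 0 "2*pi"] by simp
    have i2: "((\<lambda>x. h (l1 + of_real \<rho> * cis x)) has_integral 2 * pi * h l1) {0..2*pi}"
      using integrable_integral[OF integrable_continuous_real[OF cirh]] unfolding mb .
    have i3: "((\<lambda>x. Re (g (cis x))) has_integral 0) {0..2*pi}"
      using integrable_integral[OF integrable_continuous_real[OF circ]] unfolding mg .
    have "((\<lambda>x. u (cis x)) has_integral 2 * pi * (F1 - \<epsilon> * \<rho>\<^sup>2 / 2 - h l1) + 2 * pi * h l1 - 0) {0..2*pi}"
      unfolding u_def by (rule has_integral_diff[OF has_integral_add[OF i1 i2] i3])
    then show ?thesis by (simp add: integral_unique algebra_simps)
  qed
  moreover have "continuous_on {0..2*pi} (\<lambda>x. u (cis x))"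
    unfolding u_def by (intro continuous_intros circ cirh)
  ultimately have cm: "circle_mean (\<lambda>w. ereal (u w)) = ereal (F1 - \<epsilon> * \<rho>\<^sup>2 / 2)"
    by (simp add: circle_mean_continuous)
  have "\<forall>w\<in>cball 0 1. A w \<in> U" using AU by auto
  then have "f (A 0) \<le> circle_mean (\<lambda>w. f (A w))"
    using psh unfolding plurisubharmonic_on_def A_def by simp
  also have "\<dots> \<le> circle_mean (\<lambda>w. ereal (u w))"
    by (intro circle_mean_mono fu)
  finally have le: "f (A 0) \<le> circle_mean (\<lambda>w. ereal (u w))" .
  have A0: "A 0 = D l1 + x1" by (simp add: A_def prod_eq_iff)
  have "ereal F1 \<le> ereal (F1 - \<epsilon> * \<rho>\<^sup>2 / 2)"
    using le unfolding cm A0 F1 .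
  then show False using \<epsilon> \<rho>(1) by (simp add: mult_le_0_iff)
qed

section \<open>Holomorphic maps as competitors for the Green function\<close>

lemma psh_elog_cmod:
  assumes k: "holomorphic2_on k U"
  shows "plurisubharmonic_on (\<lambda>x. elog (cmod (k x))) U"
  unfolding plurisubharmonic_on_def
proof (intro conjI ballI allI impI)
  fix x assume x: "x \<in> U"
  show "elog (cmod (k x)) < \<infinity>" by (simp add: elog_def)
  fix M assume M: "elog (cmod (k x)) < M"
  show "\<forall>\<^sub>F y in at x within U. elog (cmod (k y)) < M"
  proof (cases M)
    case (real m)
    have "isCont k x" using k x has_derivative_continuous unfolding holomorphic2_on_def by blast
    then have "isCont (\<lambda>y. cmod (k y)) x" by (intro continuous_intros)
    then have lim: "((\<lambda>y. cmod (k y)) \<longlongrightarrow> cmod (k x)) (at x)" by (simp add: isCont_def)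
    have "cmod (k x) < exp m" using M by (simp add: real elog_less_iff)
    from order_tendstoD(2)[OF lim this] have "\<forall>\<^sub>F y in at x. cmod (k y) < exp m" .
    then have "\<forall>\<^sub>F y in at x within U. cmod (k y) < exp m"
      by (rule filter_leD[OF at_le[OF subset_UNIV]])
    then show ?thesis by (simp add: real elog_less_iff)
  next
    case PInf
    then show ?thesis by (simp add: elog_def)
  next
    case MInf
    then show ?thesis using M by simp
  qed
next
  fix a1 a2 b1 b2 assume A: "\<forall>w\<in>cball 0 1. (a1 + w * b1, a2 + w * b2) \<in> U"
  define h where "h w = k (a1 + w * b1, a2 + w * b2)" for w
  have "h field_differentiable at w" if w: "w \<in> cball 0 1" for w
  proof -
    obtain a b where "(k has_derivative (\<lambda>h. a * fst h + b * snd h)) (at (a1 + w * b1, a2 + w * b2))"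
      using k A w unfolding holomorphic2_on_def by blast
    then have "(h has_derivative (\<lambda>x. a * fst (x * b1, x * b2) + b * snd (x * b1, x * b2))) (at w)"
      unfolding h_def by (rule has_derivative_compose[rotated]) (auto intro!: derivative_eq_intros)
    then have "(h has_field_derivative (a * b1 + b * b2)) (at w)"
      unfolding has_field_derivative_def by (rule has_derivative_eq_rhs) (simp add: fun_eq_iff algebra_simps)
    then show ?thesis unfolding field_differentiable_def by blast
  qed
  then have "h holomorphic_on ball 0 1" "continuous_on (cball 0 1) h"
    by (auto simp: holomorphic_on_def field_differentiable_at_within
        intro!: continuous_at_imp_continuous_on field_differentiable_imp_continuous_at)
  from elog_norm_le_circle_mean[OF this]
  show "elog (cmod (k (a1, a2))) \<le> circle_mean (\<lambda>w. elog (cmod (k (a1 + w * b1, a2 + w * b2))))"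
    by (simp add: h_def)
qed

lemma log_pole_elog_cmod:
  assumes k: "holomorphic2_on k U" and a: "a \<in> U" "k a = 0"
  shows "log_pole (\<lambda>x. elog (cmod (k x))) U a"
proof -
  obtain A B where "(k has_derivative (\<lambda>h. A * fst h + B * snd h)) (at a)"
    using k a unfolding holomorphic2_on_def by blast
  then have "\<exists>d>0. \<forall>y. norm (y - a) < d \<longrightarrow> norm (k y - k a - (A * fst (y - a) + B * snd (y - a))) \<le> 1 * norm (y - a)"
    unfolding has_derivative_at_alt by (elim conjE allE[where x = 1]) simp
  then obtain d where d: "d > 0"
    "\<And>y. norm (y - a) < d \<Longrightarrow> norm (k y - (A * fst (y - a) + B * snd (y - a))) \<le> norm (y - a)"
    using a(2) by auto
  define C where "C = cmod A + cmod B + 1"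
  have C: "C > 0" by (simp add: C_def add_nonneg_pos)
  have *: "elog (cmod (k y)) \<le> ereal (ln (norm (y - a)) + ln C)" if y: "norm (y - a) < d" "y \<noteq> a" for y
  proof -
    have "cmod (A * fst (y - a) + B * snd (y - a)) \<le> cmod A * cmod (fst (y - a)) + cmod B * cmod (snd (y - a))"
      by (metis norm_mult norm_triangle_ineq)
    also have "\<dots> \<le> cmod A * norm (y - a) + cmod B * norm (y - a)"
      by (intro add_mono mult_left_mono norm_ge_zero norm_fst_le[of "fst (y - a)" "snd (y - a)", unfolded prod.collapse]
        norm_snd_le[of "snd (y - a)" "fst (y - a)", unfolded prod.collapse])
    finally have "cmod (k y) \<le> norm (y - a) * C"
      using d(2)[OF y(1)] norm_triangle_sub[of "k y" "A * fst (y - a) + B * snd (y - a)"]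
      by (simp add: C_def algebra_simps)
    moreover have "exp (ln (norm (y - a)) + ln C) = norm (y - a) * C"
      using y C by (simp add: exp_add)
    ultimately show ?thesis by (simp add: elog_le_iff)
  qed
  have "\<forall>\<^sub>F y in at a within U. elog (cmod (k y)) \<le> ereal (ln (norm (y - a)) + ln C)"
    unfolding eventually_at using d(1) * by (auto simp: dist_norm)
  then show ?thesis unfolding log_pole_def by blast
qed

lemma pdist_eq_mob: "pdist a b = cmod (mob b a)"
  using cmod_mob_commute[of a b] by (simp add: pdist_def mob_def)

text \<open>
  Compose the given map with the symmetrization and with the automorphism of the disk that sends
  its value at the common image \<open>(p, 0)\<close> of both poles to \<open>0\<close>; the logarithm of the modulus of
  the result competes for the Green function.
\<close>

lemma elog_pdist_le_green:
  fixes p :: complex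
  assumes f: "holomorphic2_on f sym_bidisk" "f ` sym_bidisk \<subseteq> unit_disk"
    and p: "cmod p < 1" and x: "(z1, z2) \<in> bidisk"
  shows "elog (pdist (f (z1 + z2, z1 * z2)) (f (p, 0))) \<le> green (z1, z2) (p, 0) (0, p)"
proof -
  define s where "s x = (fst x + snd x, fst x * snd x)" for x :: "complex \<times> complex"
  define b where "b = f (p, 0)"
  define k where "k x = mob b (f (s x))" for x
  have sU: "s x \<in> sym_bidisk" if "x \<in> bidisk" for x
  proof -
    have "fst x \<in> unit_disk" "snd x \<in> unit_disk" using that by auto
    then show ?thesis unfolding s_def sym_bidisk_def by blast
  qed
  have "(p, 0) = s (p, 0)" by (simp add: s_def)
  then have b: "cmod b < 1" using f(2) sU[of "(p, 0)"] p by (force simp: b_def)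
  have fs: "cmod (f (s x)) < 1" if "x \<in> bidisk" for x
    using f(2) sU[OF that] by force
  have "holomorphic2_on k bidisk"
    unfolding holomorphic2_on_def
  proof
    fix x assume x: "x \<in> bidisk"
    obtain A B where AB: "(f has_derivative (\<lambda>h. A * fst h + B * snd h)) (at (s x))"
      using f(1) sU[OF x] unfolding holomorphic2_on_def by blast
    have "(s has_derivative (\<lambda>h. (fst h + snd h, fst x * snd h + fst h * snd x))) (at x)"
      unfolding s_def by (auto intro!: derivative_eq_intros)
    from has_derivative_compose[OF this AB]
    have 1: "((\<lambda>x. f (s x)) has_derivative (\<lambda>h. (A + B * snd x) * fst h + (A + B * fst x) * snd h)) (at x)"
      by (rule has_derivative_eq_rhs) (simp add: fun_eq_iff algebra_simps)
    have "1 - cnj b * f (s x) \<noteq> 0" using cnj_mult_ne_1[OF b] fs[OF x] by simp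
    then have "\<exists>m. (mob b has_field_derivative m) (at (f (s x)))"
      unfolding mob_def by (auto intro!: derivative_eq_intros exI)
    then obtain m where "(mob b has_derivative (*) m) (at (f (s x)))"
      by (auto simp: has_field_derivative_def)
    from has_derivative_compose[OF 1 this]
    have "(k has_derivative (\<lambda>h. (m * (A + B * snd x)) * fst h + (m * (A + B * fst x)) * snd h)) (at x)"
      unfolding k_def by (rule has_derivative_eq_rhs) (simp add: fun_eq_iff algebra_simps)
    then show "\<exists>a b. (k has_derivative (\<lambda>h. a * fst h + b * snd h)) (at x)" by blast
  qed
  note hk = this
  have "k (p, 0) = 0" "k (0, p) = 0" by (simp_all add: k_def s_def b_def mob_def)
  then have lp: "log_pole (\<lambda>x. elog (cmod (k x))) bidisk (p, 0)" "log_pole (\<lambda>x. elog (cmod (k x))) bidisk (0, p)"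
    using p by (auto intro!: log_pole_elog_cmod[OF hk])
  have neg: "\<forall>y\<in>bidisk. elog (cmod (k y)) < 0"
    using elog_less_iff[of _ 0] mob_in_disk[OF b fs] by (simp add: k_def zero_ereal_def)
  have "elog (cmod (k (z1, z2))) \<le> green (z1, z2) (p, 0) (0, p)"
    unfolding green_def
    by (intro Sup_upper CollectI exI[of _ "\<lambda>x. elog (cmod (k x))"] conjI refl lp neg psh_elog_cmod[OF hk])
  then show ?thesis by (simp add: k_def s_def b_def pdist_eq_mob)
qed

text \<open>
  The functions of Agler and Young that solve the extremal problem on the symmetrized bidisk.
\<close>

definition magic :: "complex \<Rightarrow> complex \<times> complex \<Rightarrow> complex" where
  "magic \<tau> x = (2 * \<tau> * snd x - fst x) / (2 - \<tau> * fst x)"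

lemma magic_denominator:
  assumes "cmod \<tau> = 1" "x \<in> sym_bidisk"
  shows "2 - \<tau> * fst x \<noteq> 0"
proof
  assume "2 - \<tau> * fst x = 0"
  then have "cmod (\<tau> * fst x) = 2" by (metis eq_iff_diff_eq_0 norm_numeral)
  then have "cmod (fst x) = 2" using assms(1) by (simp add: norm_mult)
  moreover obtain z1 z2 where "fst x = z1 + z2" "cmod z1 < 1" "cmod z2 < 1"
    using assms(2) by (auto simp: sym_bidisk_def)
  then have "cmod (fst x) < 2" using norm_triangle_ineq[of z1 z2] by simp
  ultimately show False by simp
qed

text \<open>
  With \<open>a = \<tau> * z1\<close> and \<open>b = \<tau> * z2\<close> the difference of the squared moduli of denominator and
  numerator is a sum of two terms of the form \<open>2 * (1 - (cmod a)\<^sup>2) * (cmod (1 - b))\<^sup>2\<close>.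
\<close>

lemma magic_in_disk:
  assumes "cmod \<tau> = 1" "x \<in> sym_bidisk"
  shows "cmod (magic \<tau> x) < 1"
proof -
  obtain z1 z2 where x: "x = (z1 + z2, z1 * z2)" "cmod z1 < 1" "cmod z2 < 1"
    using assms(2) by (auto simp: sym_bidisk_def)
  define a b where "a = \<tau> * z1" and "b = \<tau> * z2"
  have ab: "cmod a < 1" "cmod b < 1" using x assms(1) by (auto simp: a_def b_def norm_mult)
  have id: "(cmod (2 - (a + b)))\<^sup>2 - (cmod (2 * a * b - (a + b)))\<^sup>2
      = 2 * (1 - (cmod a)\<^sup>2) * (cmod (1 - b))\<^sup>2 + 2 * (1 - (cmod b)\<^sup>2) * (cmod (1 - a))\<^sup>2"
    unfolding cmod_power2 by (simp add: power2_eq_square algebra_simps)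
  have "a \<noteq> 1" using ab by auto
  then have "0 < 2 * (1 - (cmod b)\<^sup>2) * (cmod (1 - a))\<^sup>2"
    using ab by (simp add: abs_square_less_1)
  moreover have "0 \<le> 2 * (1 - (cmod a)\<^sup>2) * (cmod (1 - b))\<^sup>2"
    using ab by (simp add: abs_square_le_1)
  ultimately have "(cmod (2 * a * b - (a + b)))\<^sup>2 < (cmod (2 - (a + b)))\<^sup>2" using id by linarith
  then have 1: "cmod (2 * a * b - (a + b)) < cmod (2 - (a + b))" by (simp add: power2_less_imp_less)
  have 2: "2 - \<tau> * fst x = 2 - (a + b)" "\<tau> * (2 * \<tau> * snd x - fst x) = 2 * a * b - (a + b)"
    by (simp_all add: x a_def b_def algebra_simps)
  have "cmod (2 * \<tau> * snd x - fst x) = cmod (\<tau> * (2 * \<tau> * snd x - fst x))"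
    using assms(1) norm_mult[of \<tau> "2 * \<tau> * snd x - fst x"] by simp
  also have "\<dots> < cmod (2 - \<tau> * fst x)" unfolding 2 by (rule 1)
  finally have lt: "cmod (2 * \<tau> * snd x - fst x) < cmod (2 - \<tau> * fst x)" .
  have "0 < cmod (2 - \<tau> * fst x)" using le_less_trans[OF norm_ge_zero lt] .
  with lt show ?thesis unfolding magic_def norm_divide by (simp add: divide_less_eq_1_pos)
qed

lemma holomorphic2_magic:
  assumes "cmod \<tau> = 1"
  shows "holomorphic2_on (magic \<tau>) sym_bidisk"
  unfolding holomorphic2_on_def
proof
  fix x assume x: "x \<in> sym_bidisk"
  define d where "d = 2 - \<tau> * fst x"
  have d: "d \<noteq> 0" using magic_denominator[OF assms x] by (simp add: d_def)
  have n: "((\<lambda>x. 2 * \<tau> * snd x - fst x) has_derivative (\<lambda>h. 2 * \<tau> * snd h - fst h)) (at x)"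
    by (auto intro!: derivative_eq_intros)
  have m: "((\<lambda>x. 2 - \<tau> * fst x) has_derivative (\<lambda>h. - (\<tau> * fst h))) (at x)"
    by (auto intro!: derivative_eq_intros)
  have "(magic \<tau> has_derivative (\<lambda>h. ((2 * \<tau> * snd h - fst h) * d - (2 * \<tau> * snd x - fst x) * (- (\<tau> * fst h))) / (d * d))) (at x)"
    unfolding magic_def d_def by (rule has_derivative_divide'[OF n m d[unfolded d_def]])
  then have "(magic \<tau> has_derivative (\<lambda>h. ((\<tau> * (2 * \<tau> * snd x - fst x) - d) / (d * d)) * fst h + (2 * \<tau> * d / (d * d)) * snd h)) (at x)"
    by (rule has_derivative_eq_rhs) (use d in \<open>simp add: fun_eq_iff field_simps\<close>)
  then show "\<exists>a b. (magic \<tau> has_derivative (\<lambda>h. a * fst h + b * snd h)) (at x)" by blast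
qed

lemma sym_quot_eq_pdist_magic:
  fixes p :: real and \<tau> z1 z2 :: complex
  assumes \<tau>: "cmod \<tau> = 1" and p: "\<bar>p\<bar> < 1" and z: "cmod z1 < 1" "cmod z2 < 1"
  shows "(z1 + z2) * \<tau>\<^sup>2 - p * z1 * z2 * \<tau>\<^sup>2 - 2 * \<tau> + p \<noteq> 0"
    and "sym_quot p z1 z2 \<tau> = pdist (magic \<tau> (z1 + z2, z1 * z2)) (magic \<tau> (of_real p, 0))"
proof -
  define s P T where "s = z1 + z2" and "P = z1 * z2" and "T = cnj \<tau>"
  define num den where "num = p * z1 * z2 * \<tau>\<^sup>2 - 2 * z1 * z2 * \<tau> + (z1 + z2) - p"
    and "den = (z1 + z2) * \<tau>\<^sup>2 - p * z1 * z2 * \<tau>\<^sup>2 - 2 * \<tau> + p"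
  define a b where "a = magic \<tau> (s, P)" and "b = magic \<tau> (of_real p, 0)"
  have T: "\<tau> * T = 1" unfolding T_def using \<tau> by (simp add: complex_norm_square[symmetric])
  have G: "(s, P) \<in> sym_bidisk" "(of_real p, 0) \<in> sym_bidisk"
    unfolding sym_bidisk_def s_def P_def
  proof (rule_tac [!] CollectI)
    show "\<exists>w1 w2. (z1 + z2, z1 * z2) = (w1 + w2, w1 * w2) \<and> w1 \<in> unit_disk \<and> w2 \<in> unit_disk"
      by (rule exI[of _ z1], rule exI[of _ z2]) (use z in simp)
    show "\<exists>w1 w2. (of_real p, 0) = (w1 + w2, w1 * w2) \<and> w1 \<in> unit_disk \<and> w2 \<in> unit_disk"
      by (rule exI[of _ "of_real p"], rule exI[of _ 0]) (use p in simp)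
  qed
  have nz: "2 - \<tau> * s \<noteq> 0" "2 - \<tau> * p \<noteq> 0"
    using magic_denominator[OF \<tau> G(1)] magic_denominator[OF \<tau> G(2)] by auto
  have cT: "cnj (2 - \<tau> * p) = 2 - T * p" by (simp add: T_def)
  then have nzT: "2 - T * p \<noteq> 0" using nz(2) by (metis complex_cnj_zero_iff)
  have ab: "cmod a < 1" "cmod b < 1" unfolding a_def b_def by (rule magic_in_disk[OF \<tau> G(1)], rule magic_in_disk[OF \<tau> G(2)])
  have am: "a * (2 - \<tau> * s) = 2 * \<tau> * P - s" "b * (2 - \<tau> * p) = - of_real p"
    using nz by (simp_all add: a_def b_def magic_def)
  have bm: "cnj b * (2 - T * p) = - of_real p"
    using nzT by (simp add: b_def magic_def T_def)
  have 1: "1 - cnj b * a = - 2 * T * den / ((2 - T * p) * (2 - \<tau> * s))"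
  proof (rule eq_divide_imp)
    show "(1 - cnj b * a) * ((2 - T * p) * (2 - \<tau> * s)) = - 2 * T * den"
      using am(1) bm T unfolding den_def s_def P_def by algebra
  qed (use nz nzT in simp)
  have 2: "b - a = 2 * num / ((2 - \<tau> * p) * (2 - \<tau> * s))"
  proof (rule eq_divide_imp)
    show "(b - a) * ((2 - \<tau> * p) * (2 - \<tau> * s)) = 2 * num"
      using am unfolding num_def s_def P_def by algebra
  qed (use nz in simp)
  have "1 - cnj b * a \<noteq> 0" using cnj_mult_ne_1 ab by simp
  then have den: "den \<noteq> 0" unfolding 1 by auto
  then show "(z1 + z2) * \<tau>\<^sup>2 - p * z1 * z2 * \<tau>\<^sup>2 - 2 * \<tau> + p \<noteq> 0" by (simp add: den_def)
  have "cmod T = 1" using \<tau> by (simp add: T_def)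
  moreover have "cmod (2 - T * p) = cmod (2 - \<tau> * p)" by (metis cT complex_mod_cnj)
  ultimately have "cmod (mob b a) = cmod num / cmod den"
    unfolding mob_def 1 2 using nz nzT den by (simp add: norm_divide norm_mult)
  then show "sym_quot p z1 z2 \<tau> = pdist (magic \<tau> (z1 + z2, z1 * z2)) (magic \<tau> (of_real p, 0))"
    by (simp add: pdist_eq_mob sym_quot_def num_def den_def a_def b_def s_def P_def norm_divide)
qed

section \<open>The Green function along a disk through both poles\<close>

lemma derivative_norm_bound:
  assumes "(d has_field_derivative d') (at c)"
  shows "\<forall>\<^sub>F l in at c. cmod (d l - d c) \<le> (cmod d' + 1) * cmod (l - c)"
proof -
  have "((\<lambda>l. cmod ((d l - d c) / (l - c))) \<longlongrightarrow> cmod d') (at c)"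
    using assms by (intro tendsto_norm) (simp add: has_field_derivative_iff)
  then have "\<forall>\<^sub>F l in at c. cmod ((d l - d c) / (l - c)) < cmod d' + 1"
    by (rule order_tendstoD(2)) simp
  moreover have "\<forall>\<^sub>F l in at c. l \<noteq> c" by (simp add: eventually_at_filter)
  ultimately show ?thesis
    by eventually_elim (simp add: norm_divide divide_simps less_imp_le)
qed

text \<open>
  Near the pole, \<open>f\<close> along the disk is at most \<open>ln (cmod (l - c))\<close> plus a constant, while the right-hand
  side is \<open>\<kappa> * ln (cmod (l - c))\<close> plus a bounded term.  Since \<open>\<kappa> < 1\<close>, the difference of the two
  logarithmic terms tends to \<open>-\<infinity>\<close> and absorbs the constants.
\<close>

lemma pole_bound_along_disk:
  fixes f :: "complex \<times> complex \<Rightarrow> ereal" and d1 d2 B g :: "complex \<Rightarrow> complex"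
  assumes f: "log_pole f U (d1 c, d2 c)"
    and d: "d1 holomorphic_on S" "d2 holomorphic_on S" and S: "open S" "c \<in> S"
    and DU: "\<And>l. l \<in> S \<Longrightarrow> (d1 l, d2 l) \<in> U"
    and ne: "\<forall>\<^sub>F l in at c. (d1 l, d2 l) \<noteq> (d1 c, d2 c)"
    and B: "\<And>l. B l = (l - c) * g l" and g: "isCont g c" "g c \<noteq> 0"
    and \<kappa>: "0 < \<kappa>" "\<kappa> < 1"
  shows "\<forall>\<^sub>F l in at c. f (d1 l, d2 l) \<le> ereal (\<kappa> * ln (cmod (B l)) + \<delta>)"
proof -
  define a where "a = (d1 c, d2 c)"
  obtain C where C: "\<forall>\<^sub>F y in at a within U. f y \<le> ereal (ln (norm (y - a)) + C)"
    using f unfolding log_pole_def a_def by blast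
  have der: "(d1 has_field_derivative deriv d1 c) (at c)" "(d2 has_field_derivative deriv d2 c) (at c)"
    using d S by (auto intro: holomorphic_derivI)
  define M where "M = (cmod (deriv d1 c) + 1) + (cmod (deriv d2 c) + 1)"
  have M: "M > 0" unfolding M_def by (intro add_pos_pos add_nonneg_pos norm_ge_zero zero_less_one)
  have "\<forall>\<^sub>F l in at c. l \<in> S" using S by (intro eventually_at_in_open') auto
  then have inU: "\<forall>\<^sub>F l in at c. (d1 l, d2 l) \<in> U" by (rule eventually_mono) (simp add: DU)
  have "isCont d1 c" "isCont d2 c" using der by (auto intro: DERIV_isCont)
  then have "((\<lambda>l. (d1 l, d2 l)) \<longlongrightarrow> a) (at c)"
    unfolding a_def by (intro tendsto_intros) (simp_all add: isCont_def)
  then have "filterlim (\<lambda>l. (d1 l, d2 l)) (at a within U) (at c)"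
    using inU ne unfolding filterlim_at a_def by (auto elim: eventually_elim2)
  from eventually_compose_filterlim[OF C this]
  have ev1: "\<forall>\<^sub>F l in at c. f (d1 l, d2 l) \<le> ereal (ln (norm ((d1 l, d2 l) - a)) + C)" .
  define m where "m = cmod (g c) / 2"
  have m: "m > 0" using g by (simp add: m_def)
  have "((\<lambda>l. cmod (g l)) \<longlongrightarrow> cmod (g c)) (at c)" using g(1) by (intro tendsto_norm) (simp add: isCont_def)
  then have ev2: "\<forall>\<^sub>F l in at c. m < cmod (g l)"
    by (rule order_tendstoD(1)) (use g in \<open>simp add: m_def\<close>)
  define N where "N = (\<kappa> * ln m + \<delta> - ln M - C) / (1 - \<kappa>)"
  have "((\<lambda>l. cmod (l - c)) \<longlongrightarrow> cmod (c - c)) (at c)" by (intro tendsto_intros)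
  then have ev3: "\<forall>\<^sub>F l in at c. cmod (l - c) < exp N"
    by (rule order_tendstoD(2)) simp
  have ev4: "\<forall>\<^sub>F l in at c. l \<noteq> c" by (simp add: eventually_at_filter)
  show ?thesis
    using ev1 ev2 ev3 ev4 ne derivative_norm_bound[OF der(1)] derivative_norm_bound[OF der(2)]
  proof eventually_elim
    case (elim l)
    define x where "x = cmod (l - c)"
    have x: "x > 0" using elim(4) by (simp add: x_def)
    have "norm ((d1 l, d2 l) - a) \<le> cmod (d1 l - d1 c) + cmod (d2 l - d2 c)"
      unfolding a_def diff_Pair by (rule norm_Pair_le)
    also have "\<dots> \<le> M * x" using elim(6,7) by (simp add: M_def x_def algebra_simps)
    finally have "norm ((d1 l, d2 l) - a) \<le> M * x" .
    moreover have "norm ((d1 l, d2 l) - a) > 0" using elim(5) unfolding a_def by (simp only: zero_less_norm_iff right_minus_eq) simp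
    ultimately have "ln (norm ((d1 l, d2 l) - a)) \<le> ln (M * x)" by (subst ln_le_cancel_iff) (use M x in auto)
    then have 1: "ln (norm ((d1 l, d2 l) - a)) \<le> ln M + ln x" using M x by (simp add: ln_mult)
    have "ln x < ln (exp N)" using elim(3) x unfolding x_def by (subst ln_less_cancel_iff) auto
    then have "ln x * (1 - \<kappa>) \<le> N * (1 - \<kappa>)" using \<kappa> by (intro mult_right_mono) auto
    also have "N * (1 - \<kappa>) = \<kappa> * ln m + \<delta> - ln M - C" using \<kappa> by (simp add: N_def)
    finally have 2: "ln x * (1 - \<kappa>) \<le> \<kappa> * ln m + \<delta> - ln M - C" .
    have "ln m \<le> ln (cmod (g l))" using elim(2) m by (subst ln_le_cancel_iff) auto
    then have "\<kappa> * ln m \<le> \<kappa> * ln (cmod (g l))" using \<kappa> by (intro mult_left_mono) auto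
    moreover have "ln (cmod (B l)) = ln x + ln (cmod (g l))"
    proof -
      have "0 < cmod (g l)" using elim(2) m by linarith
      then show ?thesis unfolding B norm_mult x_def[symmetric] using x by (simp add: ln_mult)
    qed
    ultimately have "ln (norm ((d1 l, d2 l) - a)) + C \<le> \<kappa> * ln (cmod (B l)) + \<delta>"
      using 1 2 by (simp add: algebra_simps)
    then show ?case using elim(1) by (meson ereal_less_eq(3) order_trans)
  qed
qed

lemma frontier_diff_balls:
  fixes c a :: complex
  assumes "l \<in> frontier (cball 0 \<rho> - ball c \<sigma> - ball a \<sigma>)"
  shows "l \<in> cball 0 \<rho>" "l \<notin> ball c \<sigma>" "l \<notin> ball a \<sigma>"
    "cmod l = \<rho> \<or> dist c l = \<sigma> \<or> dist a l = \<sigma>"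
proof -
  let ?L = "cball 0 \<rho> - ball c \<sigma> - ball a \<sigma>"
  have "closed ?L" by (intro closed_Diff) auto
  then have L: "l \<in> ?L" using assms frontier_subset_closed by blast
  then show "l \<in> cball 0 \<rho>" "l \<notin> ball c \<sigma>" "l \<notin> ball a \<sigma>" by auto
  show "cmod l = \<rho> \<or> dist c l = \<sigma> \<or> dist a l = \<sigma>"
  proof (rule ccontr)
    assume n: "\<not> ?thesis"
    let ?I = "ball 0 \<rho> - cball c \<sigma> - cball a \<sigma>"
    have "l \<in> ?I" using L n by auto
    moreover have "open ?I" by (intro open_Diff) auto
    moreover have "?I \<subseteq> ?L" by auto
    ultimately have "l \<in> interior ?L" using interior_maximal by blast
    then show False using assms by (simp add: frontier_def)
  qed
qed

lemma continuous_near_unit_circle: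
  fixes B :: "complex \<Rightarrow> complex"
  assumes B: "continuous_on (cball 0 1) B" "\<And>l. cmod l = 1 \<Longrightarrow> cmod (B l) = 1" and x: "x < 1" and w: "cmod w < 1"
  obtains \<rho> where "cmod w < \<rho>" "\<rho> < 1" "\<And>l. cmod l = \<rho> \<Longrightarrow> x < cmod (B l)"
proof -
  define K where "K = cball 0 1 \<inter> (\<lambda>l. cmod (B l)) -` {..x}"
  have "closed K" unfolding K_def
    by (intro continuous_closed_preimage continuous_intros B) auto
  then have "compact K" by (simp add: K_def compact_eq_bounded_closed bounded_Int)
  then have cK: "compact (insert w K)" by simp
  obtain m where m: "m \<in> insert w K" "\<And>l. l \<in> insert w K \<Longrightarrow> cmod l \<le> cmod m"
    using continuous_attains_sup[OF cK, of cmod] by (auto intro: continuous_intros)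
  have "cmod m < 1"
  proof (cases "m = w")
    case False
    then have "cmod m \<le> 1" "cmod (B m) \<le> x" using m(1) by (auto simp: K_def)
    then show ?thesis using B(2)[of m] x by (cases "cmod m = 1") auto
  qed (use w in simp)
  then obtain \<rho> where \<rho>: "cmod m < \<rho>" "\<rho> < 1" using dense by blast
  show ?thesis
  proof (rule that[OF _ \<rho>(2)])
    show "cmod w < \<rho>" using m(2)[of w] \<rho> by simp
    fix l assume l: "cmod l = \<rho>"
    show "x < cmod (B l)"
    proof (rule ccontr)
      assume "\<not> ?thesis"
      then have "l \<in> K" using l \<rho> by (auto simp: K_def)
      then show False using m(2)[of l] l \<rho> by simp
    qed
  qed
qed

text \<open>
  Let \<open>B\<close> be the Blaschke product with zeros \<open>c\<close> and \<open>a\<close>.  For \<open>\<kappa> < 1\<close>, a competitor satisfies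
  \<open>f (D l) \<le> \<kappa> * ln (cmod (B l)) + (1 - \<kappa>)\<close> on small circles around \<open>c\<close> and \<open>a\<close>, by its
  logarithmic poles, and on a circle close to the unit circle, because \<open>f < 0\<close> and \<open>cmod (B l)\<close>
  tends to \<open>1\<close>.  The maximum principle transports the bound to the point \<open>w\<close> between these
  circles, and \<open>\<kappa>\<close> tends to \<open>1\<close>.
\<close>

proposition green_le_along_disk:
  fixes d1 d2 :: "complex \<Rightarrow> complex"
  assumes d: "d1 holomorphic_on ball 0 1" "d2 holomorphic_on ball 0 1"
    and DU: "\<And>l. cmod l < 1 \<Longrightarrow> (d1 l, d2 l) \<in> bidisk"
    and ca: "cmod c < 1" "cmod a < 1" and w: "cmod w < 1" "w \<noteq> c" "w \<noteq> a"
    and ne: "d1 c \<noteq> d1 a"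
  shows "green (d1 w, d2 w) (d1 c, d2 c) (d1 a, d2 a) \<le> ereal (ln (cmod (mob c w * mob a w)))"
  unfolding green_def
proof (rule Sup_least)
  define B where "B l = mob c l * mob a l" for l
  have c_a: "c \<noteq> a" using ne by auto
  have hol: "B holomorphic_on ball 0 1"
    unfolding B_def mob_def using ca cnj_mult_ne_1 by (intro holomorphic_intros) auto
  have cont: "continuous_on (cball 0 1) B"
    unfolding B_def mob_def using ca cnj_mult_ne_1 by (intro continuous_intros) auto
  have circ: "cmod (B l) = 1" if l: "cmod l = 1" for l
  proof -
    have "cmod (mob b l) = 1" if b: "cmod b < 1" for b
    proof -
      have "l * cnj l = 1" using l by (simp add: complex_norm_square[symmetric])
      then have "b - l = - l * cnj (1 - cnj b * l)" by (simp add: algebra_simps)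
      then have "cmod (b - l) = cmod (1 - cnj b * l)"
        using l by (metis complex_mod_cnj mult_1 norm_minus_cancel norm_mult)
      then show ?thesis using cnj_mult_ne_1[OF b, of l] l by (simp add: mob_def norm_divide)
    qed
    then show ?thesis using ca by (simp add: B_def norm_mult)
  qed
  have B0: "B l \<noteq> 0" if "cmod l < 1" "l \<noteq> c" "l \<noteq> a" for l
    using that ca cnj_mult_ne_1 by (auto simp: B_def mob_def)
  fix y assume "y \<in> {f (d1 w, d2 w) |f. plurisubharmonic_on f bidisk \<and> (\<forall>y\<in>bidisk. f y < 0) \<and>
     log_pole f bidisk (d1 c, d2 c) \<and> log_pole f bidisk (d1 a, d2 a)}"
  then obtain f where y: "y = f (d1 w, d2 w)" and psh: "plurisubharmonic_on f bidisk"
    and neg: "\<And>x. x \<in> bidisk \<Longrightarrow> f x < 0"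
    and lp: "log_pole f bidisk (d1 c, d2 c)" "log_pole f bidisk (d1 a, d2 a)" by blast
  have main: "f (d1 w, d2 w) \<le> ereal (\<kappa> * ln (cmod (B w)) + (1 - \<kappa>))" if \<kappa>: "0 < \<kappa>" "\<kappa> < 1" for \<kappa>
  proof -
    define \<delta> where "\<delta> = 1 - \<kappa>"
    have \<delta>: "\<delta> > 0" using \<kappa> by (simp add: \<delta>_def)
    have near: "\<forall>\<^sub>F l in at b. f (d1 l, d2 l) \<le> ereal (\<kappa> * ln (cmod (B l)) + \<delta>)"
      if b: "(b = c \<and> b' = a) \<or> (b = a \<and> b' = c)" for b b'
    proof -
      have b1: "cmod b < 1" "cmod b' < 1" "b \<noteq> b'" "d1 b' - d1 b \<noteq> 0" using b ca c_a ne by auto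
      have lpb: "log_pole f bidisk (d1 b, d2 b)" using b lp by auto
      have "(\<lambda>l. d1 l - d1 b) holomorphic_on ball 0 1" by (intro holomorphic_intros d)
      then have "\<exists>r>0. \<forall>l\<in>ball b r - {b}. d1 l - d1 b \<noteq> 0"
        by (rule isolated_zeros[of "\<lambda>l. d1 l - d1 b" "ball 0 1" b b']) (use b1 in auto)
      then obtain r where r: "0 < r" "\<And>l. l \<in> ball b r - {b} \<Longrightarrow> d1 l - d1 b \<noteq> 0" by blast
      then have "\<forall>\<^sub>F l in at b. d1 l \<noteq> d1 b"
        unfolding eventually_at by (intro exI[of _ r]) (auto simp: dist_commute)
      then have nb: "\<forall>\<^sub>F l in at b. (d1 l, d2 l) \<noteq> (d1 b, d2 b)" by (rule eventually_mono) simp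
      define g where "g l = - mob b' l / (1 - cnj b * l)" for l
      have Bg: "B l = (l - b) * g l" for l
      proof -
        have "B l = mob b l * mob b' l" using b by (auto simp: B_def)
        also have "mob b l = (l - b) * (- 1 / (1 - cnj b * l))"
        proof -
          have "(l - b) * (- 1 / D) = (b - l) / D" for D :: complex
            by (cases "D = 0") (simp_all add: field_simps)
          then show ?thesis by (simp only: mob_def)
        qed
        finally show ?thesis by (simp add: g_def)
      qed
      have nz: "1 - cnj b * b \<noteq> 0" "1 - cnj b' * b \<noteq> 0" using b1 cnj_mult_ne_1 by auto
      have g1: "isCont g b" unfolding g_def mob_def using nz by (intro continuous_intros) auto
      have g2: "g b \<noteq> 0" unfolding g_def mob_def using nz b1 by simp
      show ?thesis
        by (rule pole_bound_along_disk[where S = "ball 0 1" and g = g, OF lpb d _ _ _ nb Bg g1 g2 \<kappa>])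
          (use b1 DU in auto)
    qed
    obtain \<sigma>1 where \<sigma>1: "\<sigma>1 > 0" "\<And>l. l \<noteq> c \<Longrightarrow> dist l c < \<sigma>1 \<Longrightarrow> f (d1 l, d2 l) \<le> ereal (\<kappa> * ln (cmod (B l)) + \<delta>)"
      using near[of c a] unfolding eventually_at by auto
    obtain \<sigma>2 where \<sigma>2: "\<sigma>2 > 0" "\<And>l. l \<noteq> a \<Longrightarrow> dist l a < \<sigma>2 \<Longrightarrow> f (d1 l, d2 l) \<le> ereal (\<kappa> * ln (cmod (B l)) + \<delta>)"
      using near[of a c] unfolding eventually_at by auto
    have "0 < Min {\<sigma>1, \<sigma>2, dist w c, dist w a}" using \<sigma>1 \<sigma>2 w by simp
    then obtain \<sigma> where "0 < \<sigma>" "\<sigma> < Min {\<sigma>1, \<sigma>2, dist w c, dist w a}" using dense by blast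
    then have \<sigma>: "0 < \<sigma>" "\<sigma> < \<sigma>1" "\<sigma> < \<sigma>2" "\<sigma> < dist w c" "\<sigma> < dist w a" by auto
    have "exp (- \<delta> / \<kappa>) < 1" using \<delta> \<kappa> by simp
    then obtain \<rho> where \<rho>: "cmod w < \<rho>" "\<rho> < 1" "\<And>l. cmod l = \<rho> \<Longrightarrow> exp (- \<delta> / \<kappa>) < cmod (B l)"
      using continuous_near_unit_circle[OF cont circ _ w(1)] by blast
    define L where "L = cball 0 \<rho> - ball c \<sigma> - ball a \<sigma>"
    define \<Omega> where "\<Omega> = ball 0 1 - {c, a}"
    \<comment> \<open>Scaling \<open>B\<close> by this constant adds \<open>\<delta>\<close> to \<open>\<kappa> * ln (cmod (B l))\<close>.\<close>
    define E where "E l = of_real (exp (\<delta> / \<kappa>)) * B l" for l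
    have E: "\<kappa> * ln (cmod (E l)) = \<kappa> * ln (cmod (B l)) + \<delta>" if "l \<in> \<Omega>" for l
    proof -
      have "0 < cmod (B l)" using B0[of l] that by (auto simp: \<Omega>_def)
      then show ?thesis using \<kappa> by (simp add: E_def norm_mult ln_mult distrib_left)
    qed
    have L\<Omega>: "L \<subseteq> \<Omega>" using \<sigma>(1) \<rho>(2) by (auto simp: L_def \<Omega>_def)
    have sub: "\<Omega> \<subseteq> ball 0 1" by (auto simp: \<Omega>_def)
    have wL: "w \<in> L" using \<sigma> \<rho> by (auto simp: L_def dist_commute)
    have "f (d1 w, d2 w) \<le> ereal (\<kappa> * ln (cmod (E w)))"
    proof (rule psh_maximum_principle_along_disk[where ?d1.0 = d1 and ?d2.0 = d2 and B = E and \<kappa> = \<kappa>,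
          OF psh _ _ _ L\<Omega> _ _ _ _ _ _ _ wL])
      show "open bidisk" by (intro open_Times) auto
      show "f y \<le> 0" if "y \<in> bidisk" for y using neg[OF that] by simp
      show "open \<Omega>" unfolding \<Omega>_def by (intro open_Diff) auto
      show "compact L" unfolding L_def by (intro compact_diff) auto
      show "d1 holomorphic_on \<Omega>" by (rule holomorphic_on_subset[OF d(1) sub])
      show "d2 holomorphic_on \<Omega>" by (rule holomorphic_on_subset[OF d(2) sub])
      show "(d1 l, d2 l) \<in> bidisk" if "l \<in> \<Omega>" for l using DU[of l] that sub by auto
      show "E holomorphic_on \<Omega>" unfolding E_def
        by (intro holomorphic_intros holomorphic_on_subset[OF hol sub])
      show "E l \<noteq> 0" if "l \<in> \<Omega>" for l using B0[of l] that by (auto simp: E_def \<Omega>_def)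
      fix l assume lf: "l \<in> frontier L"
      note l = frontier_diff_balls[OF lf[unfolded L_def]]
      have l\<Omega>: "l \<in> \<Omega>" using l \<rho> \<sigma>(1) by (auto simp: \<Omega>_def)
      have "f (d1 l, d2 l) \<le> ereal (\<kappa> * ln (cmod (B l)) + \<delta>)"
        using l(4)
      proof (elim disjE)
        assume "cmod l = \<rho>"
        then have gt: "exp (- \<delta> / \<kappa>) < cmod (B l)" using \<rho>(3) by simp
        have "ln (exp (- \<delta> / \<kappa>)) < ln (cmod (B l))"
          using gt le_less_trans[OF less_imp_le[OF exp_gt_zero] gt] by (subst ln_less_cancel_iff) auto
        then have "0 \<le> \<kappa> * ln (cmod (B l)) + \<delta>" using \<kappa> by (simp add: field_simps)
        moreover have "f (d1 l, d2 l) < 0" using neg DU[of l] l\<Omega> sub by auto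
        ultimately show ?thesis by (meson ereal_less_eq(5) less_imp_le order_trans)
      qed (use \<sigma>1(2)[of l] \<sigma>2(2)[of l] \<sigma> l\<Omega> in \<open>auto simp: dist_commute \<Omega>_def\<close>)
      then show "f (d1 l, d2 l) \<le> ereal (\<kappa> * ln (cmod (E l)))" by (simp add: E[OF l\<Omega>])
    qed
    then show ?thesis using E[of w] wL L\<Omega> by (auto simp: \<delta>_def)
  qed
  show "y \<le> ereal (ln (cmod (mob c w * mob a w)))"
  proof (cases "f (d1 w, d2 w)")
    case (real F)
    have "((\<lambda>\<kappa>. \<kappa> * ln (cmod (B w)) + (1 - \<kappa>)) \<longlongrightarrow> 1 * ln (cmod (B w)) + (1 - 1)) (at_left 1)"
      by (intro tendsto_intros)
    moreover have "\<forall>\<^sub>F \<kappa> in at_left 1. F \<le> \<kappa> * ln (cmod (B w)) + (1 - \<kappa>)"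
      using main unfolding real by (intro eventually_at_leftI[of 0]) auto
    ultimately have "F \<le> ln (cmod (B w))"
      using tendsto_lowerbound[of "\<lambda>\<kappa>. \<kappa> * ln (cmod (B w)) + (1 - \<kappa>)" _ "at_left (1::real)" F] by simp
    then show ?thesis by (simp add: y real B_def)
  next
    case PInf
    then show ?thesis using main[of "1/2"] by simp
  qed (simp add: y)
qed

section \<open>The main theorem\<close>

text \<open>
  The squeeze: every distance in the definition of \<open>caratheodory\<close> is at most the exponential of the
  Green function, hence at most \<open>\<rho>\<close>, and \<open>magic \<tau>0\<close> realizes \<open>\<rho>\<close>.
\<close>

lemma caratheodory_magic_bounds:
  fixes p :: real
  assumes p: "0 < p" "p < 1" and z: "cmod z1 < 1" "cmod z2 < 1" and \<tau>0: "cmod \<tau>0 = 1"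
    and g: "green (z1, z2) (of_real p, 0) (0, of_real p) \<le> ereal (ln \<rho>)" and \<rho>: "0 < \<rho>"
    and eq: "sym_quot p z1 z2 \<tau>0 = \<rho>"
  shows "caratheodory sym_bidisk (z1 + z2, z1 * z2) (of_real p, 0) = \<rho>"
    and "exp_ereal (green (z1, z2) (of_real p, 0) (0, of_real p)) = ereal \<rho>"
    and "(SUP \<tau>\<in>unit_circle. sym_quot p z1 z2 \<tau>) = \<rho>"
proof -
  let ?x = "(z1 + z2, z1 * z2)" and ?y = "(of_real p, 0) :: complex \<times> complex"
  let ?g = "green (z1, z2) (of_real p, 0) (0, of_real p)"
  define D where "D = {pdist (f ?x) (f ?y) |f. holomorphic2_on f sym_bidisk \<and> f ` sym_bidisk \<subseteq> unit_disk}"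
  have "exp_ereal ?g \<le> exp_ereal (ereal (ln \<rho>))" by (rule exp_ereal_mono[OF g])
  then have up: "exp_ereal ?g \<le> ereal \<rho>" using \<rho> by (simp add: exp_ereal_def)
  have low: "ereal e \<le> exp_ereal ?g" if e: "e \<in> D" for e
  proof -
    obtain f where f: "holomorphic2_on f sym_bidisk" "f ` sym_bidisk \<subseteq> unit_disk" "e = pdist (f ?x) (f ?y)"
      using e unfolding D_def by blast
    have "elog e \<le> ?g" unfolding f(3)
      by (rule elog_pdist_le_green[OF f(1,2)]) (use p z in auto)
    then have "exp_ereal (elog e) \<le> exp_ereal ?g" by (rule exp_ereal_mono)
    moreover have "0 \<le> e" by (simp add: f(3) pdist_def)
    ultimately show ?thesis by (simp add: exp_ereal_elog)
  qed
  have magic: "sym_quot p z1 z2 \<tau> \<in> D" if "cmod \<tau> = 1" for \<tau>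
  proof -
    have "\<bar>p\<bar> < 1" using p by simp
    moreover have "magic \<tau> ` sym_bidisk \<subseteq> unit_disk" using magic_in_disk[OF that] by auto
    ultimately show ?thesis unfolding D_def
      using sym_quot_eq_pdist_magic(2)[OF that _ z] holomorphic2_magic[OF that] by blast
  qed
  have le: "e \<le> \<rho>" if "e \<in> D" for e
    using order_trans[OF low[OF that] up] by simp
  have mem: "\<rho> \<in> D" using magic[OF \<tau>0] eq by simp
  show "caratheodory sym_bidisk ?x ?y = \<rho>"
    unfolding caratheodory_def D_def[symmetric] by (rule cSup_eq_maximum[OF mem le])
  show "exp_ereal ?g = ereal \<rho>" using low[OF mem] up by (rule antisym[rotated])
  show "(SUP \<tau>\<in>unit_circle. sym_quot p z1 z2 \<tau>) = \<rho>"
  proof (rule cSup_eq_maximum)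
    show "\<rho> \<in> (\<lambda>\<tau>. sym_quot p z1 z2 \<tau>) ` unit_circle" using \<tau>0 eq by (auto intro!: image_eqI[of _ _ \<tau>0])
    show "e \<le> \<rho>" if "e \<in> (\<lambda>\<tau>. sym_quot p z1 z2 \<tau>) ` unit_circle" for e
      using that magic le by auto
  qed
qed

text \<open>
  All conditions on the parameters are covariant under multiplying \<open>\<alpha>\<close>, \<open>\<beta>\<close>, \<open>c\<close> and \<open>w\<close> by a
  unimodular number, and dividing by \<open>v = c / cmod c\<close> makes \<open>c\<close> positive.
\<close>

lemma extremal_disk_facts:
  fixes p t :: real and u z \<alpha> \<beta> c \<omega> w z1 z2 :: complex
  assumes par: "disk_params p p u z \<alpha> \<beta> c \<omega> t" and p: "0 < p" "p < 1" and w: "cmod w < 1"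
    and z1: "z1 = w * mob \<alpha> w" and z2: "z2 = mob z (\<omega> * w * mob \<beta> w)"
  shows "cmod u = 1" "cmod z < 1" "cmod z1 < 1" "cmod z2 < 1"
    and "sym_quot p z1 z2 (cnj u) = cmod (mob c w * mob \<alpha> w)"
    and "cnj z * p * u ^ 4 - cnj z * u ^ 3 - p * u ^ 3 + p * u - p * z + u * z = 0"
proof -
  have ab: "cmod \<alpha> < 1" "cmod \<beta> < 1" "cmod c < 1" and om: "cmod \<omega> = 1" and t: "0 < t" "t < 1"
    and \<alpha>eq: "\<alpha> = mob (of_real t * \<alpha> + of_real (1 - t) * \<beta>) c"
    and pc: "c * mob \<alpha> c = p" and zc: "\<omega> * c * mob \<beta> c = z" and q: "\<omega> * \<alpha> * mob \<beta> \<alpha> = mob z p"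
    using par by (auto simp: disk_params_def Let_def)
  obtain r v where c: "c = of_real r * v" "r > 0" "cmod v = 1" "\<omega> * v\<^sup>2 = u"
    using par unfolding disk_params_def by blast
  have r: "0 < r" "r < 1" using c ab by (auto simp: norm_mult)
  show u: "cmod u = 1" using c(4) om c(3) by (metis mult_1 norm_mult norm_power power_one)
  have vv: "v * cnj v = 1" using c(3) by (simp add: complex_norm_square[symmetric])
  define \<alpha>' \<beta>' \<mu> b where "\<alpha>' = cnj v * \<alpha>" and "\<beta>' = cnj v * \<beta>" and "\<mu> = cnj v * w" and "b = mob \<beta>' r"
  have rot: "\<alpha> = v * \<alpha>'" "\<beta> = v * \<beta>'" "w = v * \<mu>" "c = v * r"
    using vv by (simp_all add: \<alpha>'_def \<beta>'_def \<mu>_def c(1) mult.assoc[symmetric])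
  have n: "cmod \<alpha>' < 1" "cmod \<beta>' < 1" "cmod \<mu> < 1"
    using ab w c(3) by (simp_all add: \<alpha>'_def \<beta>'_def \<mu>_def norm_mult)
  have b: "cmod b < 1" unfolding b_def using mob_in_disk n(2) r by simp
  note mr = mob_rotate[OF c(3)]
  have v0: "v \<noteq> 0" using c(3) by auto
  have "v * \<alpha>' = v * mob (of_real t * \<alpha>' + of_real (1 - t) * \<beta>') r"
    using \<alpha>eq unfolding rot mr[symmetric] by (simp add: algebra_simps)
  then have \<alpha>1: "\<alpha>' = mob (of_real t * \<alpha>' + of_real (1 - t) * \<beta>') r" using v0 by simp
  have p1: "of_real p = v\<^sup>2 * (r * mob \<alpha>' r)"
    using pc unfolding rot mr by (simp add: power2_eq_square mult_ac)
  have p2: "cmod (r * mob \<alpha>' r) = p"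
    using arg_cong[OF p1, of cmod] p(1) c(3) by (simp add: norm_mult norm_power)
  have zz: "z = u * (r * b)"
    using zc unfolding rot mr c(4)[symmetric] by (simp add: b_def power2_eq_square mult_ac)
  have q1: "u * (\<alpha>' * mob \<beta>' \<alpha>') = mob z p"
    using q unfolding rot mr c(4)[symmetric] by (simp add: power2_eq_square mult_ac)
  have core: "\<alpha>' = mob b r" "of_real p = u * (r * mob r \<alpha>')"
    using disk_core[OF r t n(1,2) \<alpha>1 p2 p u zz[unfolded b_def] q1] by (simp_all add: b_def)
  show z: "cmod z < 1"
  proof -
    have "r * cmod b \<le> r * 1" using r b by (intro mult_left_mono) auto
    then have "r * cmod b < 1" using r by linarith
    then show ?thesis unfolding zz norm_mult u using r by simp
  qed
  have z1': "z1 = v\<^sup>2 * (\<mu> * mob \<alpha>' \<mu>)" unfolding z1 rot(1,3) mr by (simp add: power2_eq_square mult_ac)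
  have "\<omega> * w * mob \<beta> w = u * (\<mu> * mob \<beta>' \<mu>)"
    unfolding rot(2,3) mr c(4)[symmetric] by (simp add: power2_eq_square mult_ac)
  then have z2': "z2 = u * (mob r \<mu> * mob b \<mu>)"
    unfolding z2 zz b_def using mob_rotate[OF u] mob_blaschke[of r \<beta>' \<mu>] n r by simp
  have prod: "cmod (x * y) < 1" if "cmod x < 1" "cmod y < 1" for x y
  proof -
    have "cmod x * cmod y \<le> cmod x * 1" using that by (intro mult_left_mono) auto
    then show ?thesis using that unfolding norm_mult by linarith
  qed
  have "cmod (\<mu> * mob \<alpha>' \<mu>) < 1" using n mob_in_disk by (intro prod) auto
  then show nz1: "cmod z1 < 1" unfolding z1' norm_mult[of "v\<^sup>2"] norm_power c(3) by simp
  have "cmod (mob r \<mu> * mob b \<mu>) < 1" using n b r by (intro prod mob_in_disk) auto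
  then show nz2: "cmod z2 < 1" unfolding z2' norm_mult[of u] u by simp
  have "\<bar>p\<bar> < 1" using p by simp
  note den = sym_quot_eq_pdist_magic(1)[OF _ this nz1 nz2, of "cnj u"]
  have "sym_quot p z1 z2 (cnj u) = cmod (mob r \<mu>) * cmod (mob \<alpha>' \<mu>)"
    by (rule sym_quot_of_core[OF r b u n(3) core _ p1 z1' z2' den]) (use p u in auto)
  also have "\<dots> = cmod (mob c w * mob \<alpha> w)"
    unfolding rot(1,3,4) mr norm_mult c(3) by simp
  finally show "sym_quot p z1 z2 (cnj u) = cmod (mob c w * mob \<alpha> w)" .
  show "cnj z * p * u ^ 4 - cnj z * u ^ 3 - p * u ^ 3 + p * u - p * z + u * z = 0"
    by (rule quartic_of_core[OF r b u core zz])
qed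

theorem mainTheorem4:
  fixes p q \<theta> :: real and z1 z2 u z :: complex
  assumes "0 < p" and "p < 1" and "q = p"
    and "(z1, z2) \<in> bidisk" and "(z1, z2) \<in> region2 p q"
    and "u = cis \<theta>"
    and "z \<in> A_set p q u"
    and "(z1, z2) \<in> G_map z ` phi_image p q u z"
  shows "ereal (caratheodory sym_bidisk (z1 + z2, z1 * z2) (of_real p, 0))
           = exp_ereal (green (z1, z2) (of_real p, 0) (0, of_real p)) \<and>
         caratheodory sym_bidisk (z1 + z2, z1 * z2) (of_real p, 0)
           = (SUP \<tau>\<in>unit_circle. sym_quot p z1 z2 \<tau>) \<and>
         sym_quot p z1 z2 (cis (-\<theta>)) = (SUP \<tau>\<in>unit_circle. sym_quot p z1 z2 \<tau>) \<and>
         cnj z * p * cis (4 * \<theta>) - cnj z * cis (3 * \<theta>) - p * cis (3 * \<theta>) + p * cis \<theta>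
           - p * z + cis \<theta> * z = 0"
proof -
  note p = assms(1,2)
  obtain \<alpha> \<beta> c \<omega> t w where par: "disk_params p p u z \<alpha> \<beta> c \<omega> t" and w: "cmod w < 1"
    and zz: "(z1, z2) = G_map z (phi \<alpha> \<beta> \<omega> w)"
    using assms(3,8) unfolding phi_image_def by auto
  have z1: "z1 = w * mob \<alpha> w" and z2: "z2 = mob z (\<omega> * w * mob \<beta> w)"
    using zz by (simp_all add: G_map_def phi_def)
  have ab: "cmod \<alpha> < 1" "cmod \<beta> < 1" "cmod c < 1" and om: "cmod \<omega> = 1"
    and pc: "c * mob \<alpha> c = p" and zc: "\<omega> * c * mob \<beta> c = z" and qa: "\<omega> * \<alpha> * mob \<beta> \<alpha> = mob z p"
    using par by (auto simp: disk_params_def Let_def)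
  note facts = extremal_disk_facts[OF par p w z1 z2]
  define d1 d2 where "d1 l = l * mob \<alpha> l" and "d2 l = mob z (\<omega> * l * mob \<beta> l)" for l
  have \<beta>in: "cmod (\<omega> * l * mob \<beta> l) < 1" "cmod (l * mob \<alpha> l) < 1" if "cmod l < 1" for l
    using extremal_disk_facts(3)[OF par p that refl refl] mob_in_disk[OF ab(2) that] that om
    by (auto simp: norm_mult intro: le_less_trans[OF mult_left_le])
  have nz: "1 - cnj z * (\<omega> * l * mob \<beta> l) \<noteq> 0" if "cmod l < 1" for l
    using cnj_mult_ne_1[OF facts(2)] \<beta>in[OF that] by simp
  have hm: "mob b holomorphic_on ball 0 1" if "cmod b < 1" for b
    unfolding mob_def using cnj_mult_ne_1[OF that] by (intro holomorphic_intros) auto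
  have hol: "d1 holomorphic_on ball 0 1" "d2 holomorphic_on ball 0 1"
  proof -
    show "d1 holomorphic_on ball 0 1" unfolding d1_def by (intro holomorphic_intros hm ab)
    show "d2 holomorphic_on ball 0 1"
      unfolding d2_def mob_def[of z] using nz by (intro holomorphic_intros hm ab) auto
  qed
  have poles: "d1 c = p" "d2 c = 0" "d1 \<alpha> = 0" "d2 \<alpha> = p"
  proof -
    show "d1 c = p" using pc by (simp add: d1_def)
    show "d2 c = 0" using zc by (simp add: d2_def mob_def)
    show "d1 \<alpha> = 0" by (simp add: d1_def mob_def)
    show "d2 \<alpha> = p" using qa mob_mob[OF facts(2), of p] p by (simp add: d2_def)
  qed
  have dw: "d1 w = z1" "d2 w = z2" by (simp_all add: d1_def d2_def z1 z2)
  \<comment> \<open>Both poles lie in the third region.\<close>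
  have n3: "\<not> (cmod (mob z1 p) = cmod z2 \<or> cmod z1 = cmod (mob z2 p))"
    using assms(3-5) by (auto simp: region2_def region3_def)
  have wc: "w \<noteq> c" using n3 dw poles by (auto simp: mob_def)
  have wa: "w \<noteq> \<alpha>" using n3 dw poles by (auto simp: mob_def)
  have "green (d1 w, d2 w) (d1 c, d2 c) (d1 \<alpha>, d2 \<alpha>) \<le> ereal (ln (cmod (mob c w * mob \<alpha> w)))"
  proof (rule green_le_along_disk[OF hol _ ab(3,1) w wc wa])
    show "(d1 l, d2 l) \<in> bidisk" if "cmod l < 1" for l
      using extremal_disk_facts(3,4)[OF par p that refl refl] by (simp add: d1_def d2_def)
    show "d1 c \<noteq> d1 \<alpha>" using poles p by simp
  qed
  then have g: "green (z1, z2) (of_real p, 0) (0, of_real p) \<le> ereal (ln (cmod (mob c w * mob \<alpha> w)))"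
    by (simp add: poles dw)
  have \<rho>: "0 < cmod (mob c w * mob \<alpha> w)"
    using wc wa cnj_mult_ne_1[OF ab(3), of w] cnj_mult_ne_1[OF ab(1), of w] w by (simp add: mob_def)
  have cu: "cnj u = cis (- \<theta>)" by (simp add: assms(6) cis_cnj)
  have "cmod (cnj u) = 1" using facts(1) by simp
  note res = caratheodory_magic_bounds[OF p facts(3,4) this g \<rho> facts(5)]
  have pw: "cis (4 * \<theta>) = u ^ 4" "cis (3 * \<theta>) = u ^ 3" "cis \<theta> = u"
    using Complex.DeMoivre[of \<theta> 4] Complex.DeMoivre[of \<theta> 3] by (simp_all add: assms(6))
  show ?thesis
    unfolding pw using res facts(5,6) cu by simp
qed

end
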